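(* Let the setting, the relaxation functions, and the stochastic optimal control problem $$\text{(SOC)}\qquad \min_{\mathbf{p}\in\overline{P}}\ \mathcal{G}(\mathbf{p})\equiv\mathbb{E}[g(\mathbf{p},\boldsymbol{\omega},\mathbf{x}(t_f,\mathbf{p},\boldsymbol{\omega}))]$$ be as described in the context. Let $\Phi=\{\Omega_i\}_{i=1}^n$ be an interval partition of $\overline{\Omega}$ and write $\boldsymbol{\omega}_i\equiv\mathbb{E}[\boldsymbol{\omega}|\Omega_i]$. (Lower bound) For any $P\in\mathbb{I}\overline{P}$, a lower bound on the optimal objective value of (SOC) restricted to $P$ (i.e. of $\min_{\mathbf{p}\in P}\mathcal{G}(\mathbf{p})$) is given by the optimal objective value of the following deterministic convex optimal control problem: $$\min_{\mathbf{p}\in P}\ \sum_{i=1}^n\mathbb{P}(\Omega_i)\,g^{cv}_{P\times\Omega_i}(\mathbf{p},\boldsymbol{\omega}_i,\mathbf{x}^{cv}_i(t_f,\mathbf{p}),\mathbf{x}^{cc}_i(t_f,\mathbf{p})),$$ where $\mathbf{x}^{cv}_i(t,\mathbf{p})$ and $\mathbf{x}^{cc}_i(t,\mathbf{p})$ are the unique solutions of the $n$ independent systems of ODEs given for each $i\in\{1,\ldots,n\}$ by $$\dot{\mathbf{x}}_i^{cv}(t,\mathbf{p})=\mathbf{f}^{cv}_{P\times\Omega_i}(t,\mathbf{p},\boldsymbol{\omega}_i,\mathbf{x}^{cv}_i(t,\mathbf{p}),\mathbf{x}^{cc}_i(t,\mathbf{p})),$$ $$\dot{\mathbf{x}}_i^{cc}(t,\mathbf{p})=\mathbf{f}^{cc}_{P\times\Omega_i}(t,\mathbf{p},\boldsymbol{\omega}_i,\mathbf{x}^{cv}_i(t,\mathbf{p}),\mathbf{x}^{cc}_i(t,\mathbf{p})),$$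 $$\mathbf{x}^{cv}_i(t_0,\mathbf{p})=\mathbf{x}^{cv}_{0,P\times\Omega_i}(\mathbf{p},\boldsymbol{\omega}_i),\qquad \mathbf{x}^{cc}_i(t_0,\mathbf{p})=\mathbf{x}^{cc}_{0,P\times\Omega_i}(\mathbf{p},\boldsymbol{\omega}_i).$$ (Upper bound) Moreover, for any $\mathbf{p}\in P$, an upper bound on the optimal objective value of (SOC) restricted to $P$ is given by the value $$\sum_{i=1}^n\mathbb{P}(\Omega_i)\,g^{cc}_{[\mathbf{p},\mathbf{p}]\times\Omega_i}(\mathbf{p},\boldsymbol{\omega}_i,\mathbf{x}^{cv}_i(t_f,\mathbf{p}),\mathbf{x}^{cc}_i(t_f,\mathbf{p})),$$ where $\mathbf{x}^{cv}_i(t,\mathbf{p})$ and $\mathbf{x}^{cc}_i(t,\mathbf{p})$ now denote the unique solutions of the $n$ independent systems of ODEs given for each $i\in\{1,\ldots,n\}$ by $$\dot{\mathbf{x}}_i^{cv}(t,\mathbf{p})=\mathbf{f}^{cv}_{[\mathbf{p},\mathbf{p}]\times\Omega_i}(t,\mathbf{p},\boldsymbol{\omega}_i,\mathbf{x}^{cv}_i(t,\mathbf{p}),\mathbf{x}^{cc}_i(t,\mathbf{p})),$$ $$\dot{\mathbf{x}}_i^{cc}(t,\mathbf{p})=\mathbf{f}^{cc}_{[\mathbf{p},\mathbf{p}]\times\Omega_i}(t,\mathbf{p},\boldsymbol{\omega}_i,\mathbf{x}^{cv}_i(t,\mathbf{p}),\mathbf{x}^{cc}_i(t,\mathbf{p})),$$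 $$\mathbf{x}^{cv}_i(t_0,\mathbf{p})=\mathbf{x}^{cv}_{0,[\mathbf{p},\mathbf{p}]\times\Omega_i}(\mathbf{p},\boldsymbol{\omega}_i),\qquad \mathbf{x}^{cc}_i(t_0,\mathbf{p})=\mathbf{x}^{cc}_{0,[\mathbf{p},\mathbf{p}]\times\Omega_i}(\mathbf{p},\boldsymbol{\omega}_i).$$
   Context: **Notation.** For $\mathbf{s}^L,\mathbf{s}^U\in\mathbb{R}^n$ with $\mathbf{s}^L\le\mathbf{s}^U$ (componentwise), $[\mathbf{s}^L,\mathbf{s}^U]=\{\mathbf{s}\in\mathbb{R}^n:\mathbf{s}^L\le\mathbf{s}\le\mathbf{s}^U\}$ is a compact $n$-dimensional interval (degenerate intervals such as $[\mathbf{p},\mathbf{p}]=\{\mathbf{p}\}$ are allowed). For $\overline{S}\subset\mathbb{R}^n$, $\mathbb{I}\overline{S}$ denotes the set of all compact interval subsets of $\overline{S}$. The optimal objective value of a minimization problem is understood as the infimum of its objective over its feasible set; a problem $\min_{\mathbf{p}\in P}$ over an interval $P$ is convex if its objective is a convex function of $\mathbf{p}$ on $P$. **Relaxations.** Let $S\subset\mathbb{R}^n$ be convex and $h:S\to\mathbb{R}$. Functions $h^{cv},h^{cc}:S\to\mathbb{R}$ are convex and concave relaxations of $h$ on $S$, respectively, if $h^{cv}$ is convex on $S$, $h^{cc}$ is concave on $S$, and $h^{cv}(\mathbf{s})\le h(\mathbf{s})\le h^{cc}(\mathbf{s})$ for all $\mathbf{s}\in S$. For vector-valued functions this is understood componentwise.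 **Setting.** Let $I=[t_0,t_f]\subset\mathbb{R}$, let $\overline{P}\subset\mathbb{R}^{n_p}$ be a compact interval, and let $\boldsymbol{\omega}$ be a random vector with probability density function $p:\mathbb{R}^{n_\omega}\to\mathbb{R}$ that is zero outside a compact interval $\overline{\Omega}\subset\mathbb{R}^{n_\omega}$. Let $\mathbf{x}_0:\mathbb{R}^{n_p}\times\mathbb{R}^{n_\omega}\to\mathbb{R}^{n_x}$ and $\mathbf{f}:\mathbb{R}\times\mathbb{R}^{n_p}\times\mathbb{R}^{n_\omega}\times\mathbb{R}^{n_x}\to\mathbb{R}^{n_x}$ be locally Lipschitz continuous, and assume that for every $(\mathbf{p},\boldsymbol{\omega})\in\overline{P}\times\overline{\Omega}$ the initial value problem $\dot{\mathbf{x}}(t,\mathbf{p},\boldsymbol{\omega})=\mathbf{f}(t,\mathbf{p},\boldsymbol{\omega},\mathbf{x}(t,\mathbf{p},\boldsymbol{\omega}))$, $\mathbf{x}(t_0,\mathbf{p},\boldsymbol{\omega})=\mathbf{x}_0(\mathbf{p},\boldsymbol{\omega})$ (dot denoting the derivative in $t$) has a unique solution $\mathbf{x}(\cdot,\mathbf{p},\boldsymbol{\omega})$ on all of $I$. Let $g:\mathbb{R}^{n_p}\times\mathbb{R}^{n_\omega}\times\mathbb{R}^{n_x}\to\mathbb{R}$ and $$\mathcal{G}(\mathbf{p})\equiv\mathbb{E}[g(\mathbf{p},\boldsymbol{\omega},\mathbf{x}(t_f,\mathbf{p},\boldsymbol{\omega}))]=\int_{\overline{\Omega}}g(\mathbf{p},\boldsymbol{\omega},\mathbf{x}(t_f,\mathbf{p},\boldsymbol{\omega}))\,p(\boldsymbol{\omega})\,d\boldsymbol{\omega},$$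 which is assumed to exist for every $\mathbf{p}\in\overline{P}$. **Assumption on available relaxation functions.** For all intervals $P\in\mathbb{I}\overline{P}$, $\Omega\in\mathbb{I}\overline{\Omega}$, the following functions are given: 1. $\mathbf{x}_{0,P\times\Omega}^{cv},\mathbf{x}_{0,P\times\Omega}^{cc}:P\times\Omega\to\mathbb{R}^{n_x}$ are continuous convex and concave relaxations of $\mathbf{x}_0$ on $P\times\Omega$. 2. $\mathbf{f}^{cv}_{P\times\Omega},\mathbf{f}^{cc}_{P\times\Omega}:I\times P\times\Omega\times\mathbb{R}^{n_x}\times\mathbb{R}^{n_x}\to\mathbb{R}^{n_x}$ are Lipschitz continuous and satisfy: for any continuous $\boldsymbol{\phi},\boldsymbol{\psi}:I\times P\times\Omega\to\mathbb{R}^{n_x}$ and any fixed $t\in I$, the functions $(\mathbf{p},\boldsymbol{\omega})\mapsto\mathbf{f}^{cv}_{P\times\Omega}(t,\mathbf{p},\boldsymbol{\omega},\boldsymbol{\phi}(t,\mathbf{p},\boldsymbol{\omega}),\boldsymbol{\psi}(t,\mathbf{p},\boldsymbol{\omega}))$ and $(\mathbf{p},\boldsymbol{\omega})\mapsto\mathbf{f}^{cc}_{P\times\Omega}(t,\mathbf{p},\boldsymbol{\omega},\boldsymbol{\phi}(t,\mathbf{p},\boldsymbol{\omega}),\boldsymbol{\psi}(t,\mathbf{p},\boldsymbol{\omega}))$ are respectively convex and concave relaxations of $(\mathbf{p},\boldsymbol{\omega})\mapsto\mathbf{f}(t,\mathbf{p},\boldsymbol{\omega},\mathbf{x}(t,\mathbf{p},\boldsymbol{\omega}))$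 on $P\times\Omega$, provided that $\boldsymbol{\phi}(t,\cdot,\cdot)$ and $\boldsymbol{\psi}(t,\cdot,\cdot)$ are respectively convex and concave relaxations of $\mathbf{x}(t,\cdot,\cdot)$ on $P\times\Omega$. 3. $g^{cv}_{P\times\Omega},g^{cc}_{P\times\Omega}:P\times\Omega\times\mathbb{R}^{n_x}\times\mathbb{R}^{n_x}\to\mathbb{R}$ are Lipschitz continuous and satisfy: for any continuous $\boldsymbol{\phi},\boldsymbol{\psi}:P\times\Omega\to\mathbb{R}^{n_x}$, the functions $(\mathbf{p},\boldsymbol{\omega})\mapsto g^{cv}_{P\times\Omega}(\mathbf{p},\boldsymbol{\omega},\boldsymbol{\phi}(\mathbf{p},\boldsymbol{\omega}),\boldsymbol{\psi}(\mathbf{p},\boldsymbol{\omega}))$ and $(\mathbf{p},\boldsymbol{\omega})\mapsto g^{cc}_{P\times\Omega}(\mathbf{p},\boldsymbol{\omega},\boldsymbol{\phi}(\mathbf{p},\boldsymbol{\omega}),\boldsymbol{\psi}(\mathbf{p},\boldsymbol{\omega}))$ are respectively convex and concave relaxations of $(\mathbf{p},\boldsymbol{\omega})\mapsto g(\mathbf{p},\boldsymbol{\omega},\mathbf{x}(t_f,\mathbf{p},\boldsymbol{\omega}))$ on $P\times\Omega$, provided that $\boldsymbol{\phi}$ and $\boldsymbol{\psi}$ are respectively convex and concave relaxations of $\mathbf{x}(t_f,\cdot,\cdot)$ on $P\times\Omega$. **Interval partition.** A collection $\Phi=\{\Omega_i\}_{i=1}^n$ of intervals $\Omega_i\in\mathbb{I}\overline{\Omega}$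 is an interval partition of $\overline{\Omega}$ if $\overline{\Omega}=\bigcup_{i=1}^n\Omega_i$ and $\mathrm{int}(\Omega_i)\cap\mathrm{int}(\Omega_j)=\emptyset$ for all distinct $i,j$. **Conditional expectation.** For measurable $\Omega\subset\overline{\Omega}$, $\mathbb{P}(\Omega)$ denotes the probability of the event $\boldsymbol{\omega}\in\Omega$ and $\mathbb{E}[\cdot|\Omega]$ the expected value conditioned on the event $\boldsymbol{\omega}\in\Omega$. Convention: if $\mathbb{P}(\Omega_i)=0$, then $\boldsymbol{\omega}_i$ may be taken to be any point of $\Omega_i$ (the $i$-th term of the sums is then zero). *)

theory Defs
  imports "HOL-Probability.Probability"
begin

definition compact_intervals :: "(real^'n) set \<Rightarrow> (real^'n) set set" where
  "compact_intervals S = {{sL..sU} | sL sU. sL \<le> sU \<and> {sL..sU} \<subseteq> S}"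

definition interval_partition :: "(real^'n) set \<Rightarrow> nat \<Rightarrow> (nat \<Rightarrow> (real^'n) set) \<Rightarrow> bool" where
  "interval_partition S n \<Omega> \<longleftrightarrow>
    (\<forall>i\<in>{1..n}. \<Omega> i \<in> compact_intervals S) \<and>
    S = (\<Union>i\<in>{1..n}. \<Omega> i) \<and>
    (\<forall>i\<in>{1..n}. \<forall>j\<in>{1..n}. i \<noteq> j \<longrightarrow> interior (\<Omega> i) \<inter> interior (\<Omega> j) = {})"

text \<open>Convexity of \<open>S\<close> is part of \<^const>\<open>convex_on\<close> and \<^const>\<open>concave_on\<close>.\<close>

definition convex_relaxation_on ::
  "'a::real_vector set \<Rightarrow> ('a \<Rightarrow> real) \<Rightarrow> ('a \<Rightarrow> real) \<Rightarrow> bool" where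
  "convex_relaxation_on S h hcv \<longleftrightarrow> convex_on S hcv \<and> (\<forall>s\<in>S. hcv s \<le> h s)"

definition concave_relaxation_on ::
  "'a::real_vector set \<Rightarrow> ('a \<Rightarrow> real) \<Rightarrow> ('a \<Rightarrow> real) \<Rightarrow> bool" where
  "concave_relaxation_on S h hcc \<longleftrightarrow> concave_on S hcc \<and> (\<forall>s\<in>S. h s \<le> hcc s)"

definition vec_convex_relaxation_on ::
  "'a::real_vector set \<Rightarrow> ('a \<Rightarrow> real^'n) \<Rightarrow> ('a \<Rightarrow> real^'n) \<Rightarrow> bool" where
  "vec_convex_relaxation_on S h hcv \<longleftrightarrow>
    (\<forall>k. convex_relaxation_on S (\<lambda>s. h s $ k) (\<lambda>s. hcv s $ k))"

definition vec_concave_relaxation_on ::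
  "'a::real_vector set \<Rightarrow> ('a \<Rightarrow> real^'n) \<Rightarrow> ('a \<Rightarrow> real^'n) \<Rightarrow> bool" where
  "vec_concave_relaxation_on S h hcc \<longleftrightarrow>
    (\<forall>k. concave_relaxation_on S (\<lambda>s. h s $ k) (\<lambda>s. hcc s $ k))"

text \<open>The library's \<^const>\<open>local_lipschitz\<close> requires a Lipschitz estimate in the second argument
  only; here the estimate is joint in all arguments.\<close>

definition locally_lipschitz :: "('a::metric_space \<Rightarrow> 'b::metric_space) \<Rightarrow> bool" where
  "locally_lipschitz h \<longleftrightarrow> (\<forall>s. \<exists>u>0. \<exists>L. L-lipschitz_on (ball s u) h)"

text \<open>At the end points of the time interval the derivative is one-sided.\<close>

definition solves_ivp ::
  "real \<Rightarrow> real \<Rightarrow> (real \<Rightarrow> 'a \<Rightarrow> 'a::real_normed_vector) \<Rightarrow> 'a \<Rightarrow> (real \<Rightarrow> 'a) \<Rightarrow> bool" where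
  "solves_ivp t0 tf F y0 y \<longleftrightarrow>
    y t0 = y0 \<and>
    (\<forall>t\<in>{t0..tf}. (y has_vector_derivative F t (y t)) (at t within {t0..tf}))"

definition unique_ivp_solution ::
  "real \<Rightarrow> real \<Rightarrow> (real \<Rightarrow> 'a \<Rightarrow> 'a::real_normed_vector) \<Rightarrow> 'a \<Rightarrow> (real \<Rightarrow> 'a) \<Rightarrow> bool" where
  "unique_ivp_solution t0 tf F y0 y \<longleftrightarrow>
    solves_ivp t0 tf F y0 y \<and>
    (\<forall>z. solves_ivp t0 tf F y0 z \<longrightarrow> (\<forall>t\<in>{t0..tf}. z t = y t))"

definition unique_relaxed_solution ::
  "real \<Rightarrow> real \<Rightarrow>
   (real \<times> 'p \<times> 'w \<times> 'x \<times> 'x \<Rightarrow> 'x) \<Rightarrow> (real \<times> 'p \<times> 'w \<times> 'x \<times> 'x \<Rightarrow> 'x) \<Rightarrow>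
   ('p \<times> 'w \<Rightarrow> 'x) \<Rightarrow> ('p \<times> 'w \<Rightarrow> 'x::real_normed_vector) \<Rightarrow>
   'p \<Rightarrow> 'w \<Rightarrow> (real \<Rightarrow> 'x) \<Rightarrow> (real \<Rightarrow> 'x) \<Rightarrow> bool" where
  "unique_relaxed_solution t0 tf fcv fcc x0cv x0cc p w xcv xcc \<longleftrightarrow>
    unique_ivp_solution t0 tf
      (\<lambda>t (y, z). (fcv (t, p, w, y, z), fcc (t, p, w, y, z)))
      (x0cv (p, w), x0cc (p, w))
      (\<lambda>t. (xcv t, xcc t))"

definition initial_relaxations ::
  "((real^'p) \<times> (real^'w) \<Rightarrow> real^'x) \<Rightarrow> (real^'p) set \<Rightarrow> (real^'w) set \<Rightarrow>
   ((real^'p) \<times> (real^'w) \<Rightarrow> real^'x) \<Rightarrow> ((real^'p) \<times> (real^'w) \<Rightarrow> real^'x) \<Rightarrow> bool" where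
  "initial_relaxations x0 P \<Omega> x0cv x0cc \<longleftrightarrow>
    continuous_on (P \<times> \<Omega>) x0cv \<and> continuous_on (P \<times> \<Omega>) x0cc \<and>
    vec_convex_relaxation_on (P \<times> \<Omega>) x0 x0cv \<and>
    vec_concave_relaxation_on (P \<times> \<Omega>) x0 x0cc"

definition dynamics_relaxations ::
  "real \<Rightarrow> real \<Rightarrow> (real \<times> (real^'p) \<times> (real^'w) \<times> (real^'x) \<Rightarrow> real^'x) \<Rightarrow>
   (real \<Rightarrow> real^'p \<Rightarrow> real^'w \<Rightarrow> real^'x) \<Rightarrow> (real^'p) set \<Rightarrow> (real^'w) set \<Rightarrow>
   (real \<times> (real^'p) \<times> (real^'w) \<times> (real^'x) \<times> (real^'x) \<Rightarrow> real^'x) \<Rightarrow>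
   (real \<times> (real^'p) \<times> (real^'w) \<times> (real^'x) \<times> (real^'x) \<Rightarrow> real^'x) \<Rightarrow> bool" where
  "dynamics_relaxations t0 tf f x P \<Omega> fcv fcc \<longleftrightarrow>
    (\<exists>L. L-lipschitz_on ({t0..tf} \<times> P \<times> \<Omega> \<times> UNIV \<times> UNIV) fcv) \<and>
    (\<exists>L. L-lipschitz_on ({t0..tf} \<times> P \<times> \<Omega> \<times> UNIV \<times> UNIV) fcc) \<and>
    (\<forall>\<phi> \<psi>. continuous_on ({t0..tf} \<times> P \<times> \<Omega>) \<phi> \<longrightarrow> continuous_on ({t0..tf} \<times> P \<times> \<Omega>) \<psi> \<longrightarrow>
      (\<forall>t\<in>{t0..tf}.
        vec_convex_relaxation_on (P \<times> \<Omega>) (\<lambda>(p, w). x t p w) (\<lambda>(p, w). \<phi> (t, p, w)) \<longrightarrow>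
        vec_concave_relaxation_on (P \<times> \<Omega>) (\<lambda>(p, w). x t p w) (\<lambda>(p, w). \<psi> (t, p, w)) \<longrightarrow>
          vec_convex_relaxation_on (P \<times> \<Omega>) (\<lambda>(p, w). f (t, p, w, x t p w))
            (\<lambda>(p, w). fcv (t, p, w, \<phi> (t, p, w), \<psi> (t, p, w))) \<and>
          vec_concave_relaxation_on (P \<times> \<Omega>) (\<lambda>(p, w). f (t, p, w, x t p w))
            (\<lambda>(p, w). fcc (t, p, w, \<phi> (t, p, w), \<psi> (t, p, w)))))"

definition cost_relaxations ::
  "real \<Rightarrow> ((real^'p) \<times> (real^'w) \<times> (real^'x) \<Rightarrow> real) \<Rightarrow>
   (real \<Rightarrow> real^'p \<Rightarrow> real^'w \<Rightarrow> real^'x) \<Rightarrow> (real^'p) set \<Rightarrow> (real^'w) set \<Rightarrow>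
   ((real^'p) \<times> (real^'w) \<times> (real^'x) \<times> (real^'x) \<Rightarrow> real) \<Rightarrow>
   ((real^'p) \<times> (real^'w) \<times> (real^'x) \<times> (real^'x) \<Rightarrow> real) \<Rightarrow> bool" where
  "cost_relaxations tf g x P \<Omega> gcv gcc \<longleftrightarrow>
    (\<exists>L. L-lipschitz_on (P \<times> \<Omega> \<times> UNIV \<times> UNIV) gcv) \<and>
    (\<exists>L. L-lipschitz_on (P \<times> \<Omega> \<times> UNIV \<times> UNIV) gcc) \<and>
    (\<forall>\<phi> \<psi>. continuous_on (P \<times> \<Omega>) \<phi> \<longrightarrow> continuous_on (P \<times> \<Omega>) \<psi> \<longrightarrow>
      vec_convex_relaxation_on (P \<times> \<Omega>) (\<lambda>(p, w). x tf p w) \<phi> \<longrightarrow>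
      vec_concave_relaxation_on (P \<times> \<Omega>) (\<lambda>(p, w). x tf p w) \<psi> \<longrightarrow>
        convex_relaxation_on (P \<times> \<Omega>) (\<lambda>(p, w). g (p, w, x tf p w))
          (\<lambda>(p, w). gcv (p, w, \<phi> (p, w), \<psi> (p, w))) \<and>
        concave_relaxation_on (P \<times> \<Omega>) (\<lambda>(p, w). g (p, w, x tf p w))
          (\<lambda>(p, w). gcc (p, w, \<phi> (p, w), \<psi> (p, w))))"

text \<open>Probability of, and expectation conditioned on, the event \<open>W \<in> A\<close>;
  \<^const>\<open>uniform_measure\<close> is the conditional probability measure given an event of positive
  probability.\<close>

definition prob_in :: "'s measure \<Rightarrow> ('s \<Rightarrow> 'w) \<Rightarrow> 'w set \<Rightarrow> real" where
  "prob_in M W A = measure M (W -` A \<inter> space M)"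

definition cond_expectation_in ::
  "'s measure \<Rightarrow> ('s \<Rightarrow> 'w::{banach, second_countable_topology}) \<Rightarrow> 'w set \<Rightarrow> 'w" where
  "cond_expectation_in M W A = integral\<^sup>L (uniform_measure M (W -` A \<inter> space M)) W"

text \<open>The expected cost is written as an integral against the density \<open>\<rho>\<close>, because the state
  \<open>x tf p w\<close> is only meaningful for \<open>w \<in> S\<close>; \<open>expected_cost_eq_expectation\<close> relates it to the
  expectation on the sample space.\<close>

definition expected_cost ::
  "real \<Rightarrow> ((real^'p) \<times> (real^'w) \<times> (real^'x) \<Rightarrow> real) \<Rightarrow>
   (real \<Rightarrow> real^'p \<Rightarrow> real^'w \<Rightarrow> real^'x) \<Rightarrow> (real^'w) set \<Rightarrow> (real^'w \<Rightarrow> real) \<Rightarrow>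
   real^'p \<Rightarrow> real" where
  "expected_cost tf g x S \<rho> p = (LINT w:S|lebesgue. g (p, w, x tf p w) * \<rho> w)"

lemma expected_cost_eq_expectation:
  assumes "distributed M lborel W (\<lambda>w. ennreal (\<rho> w))" "\<And>w. 0 \<le> \<rho> w"
    and "\<And>w. w \<notin> S \<Longrightarrow> \<rho> w = 0"
    and "(\<lambda>w. g (p, w, x tf p w)) \<in> borel_measurable borel"
  shows "expected_cost tf g x S \<rho> p = (\<integral>s. g (p, W s, x tf p (W s)) \<partial>M)"
proof -
  have [measurable]: "\<rho> \<in> borel_measurable borel"
    using distributed_real_measurable[OF _ assms(1)] assms(2) by simp
  have "expected_cost tf g x S \<rho> p = (LINT w|lebesgue. \<rho> w * g (p, w, x tf p w))"
    unfolding expected_cost_def set_lebesgue_integral_def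
    by (intro Bochner_Integration.integral_cong) (auto simp: indicator_def assms(3))
  also have "\<dots> = (LINT w|lborel. \<rho> w * g (p, w, x tf p w))"
    using assms(4) by (intro integral_completion) simp
  also have "\<dots> = (\<integral>s. g (p, W s, x tf p (W s)) \<partial>M)"
    using assms by (intro distributed_integral) auto
  finally show ?thesis .
qed

text \<open>The infimum is taken in the extended reals, so that an objective unbounded below has optimal
  value \<open>-\<infinity>\<close>.\<close>

definition optimal_value :: "'p set \<Rightarrow> ('p \<Rightarrow> real) \<Rightarrow> ereal" where
  "optimal_value P J = (INF p\<in>P. ereal (J p))"

end

(* Picard iteration for the relaxed system starts at constant bounds of the original flow, and every
   step is an integral of relaxations of the right-hand side, hence again a convex and concave
   relaxation of the flow. The iterates converge, so the relaxed solutions are continuous convex and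
   concave relaxations, jointly in the decision and the random parameter. On each cell Jensen's
   inequality then bounds the cost integral by the relaxed cost at the conditional mean, and
   the cells overlap only in null sets. The upper bound is the lower bound for -g at a single point. *)

theory Submission
  imports Defs
begin

section \<open>Picard iteration with parameters\<close>

text \<open>The hypotheses say nothing about convexity of the relaxed dynamics in their state
  arguments. They only speak of compositions with jointly continuous functions that already are
  relaxations of the flow, so convexity of the relaxed solutions cannot be read off the ODEs and has
  to be carried through an approximation scheme. Three requirements follow. The iterates must be
  jointly continuous in time and parameters, hence the Picard operator acts on functions of the
  pair. The target must be reproduced by each step: the exact flow is its own initial value plus the
  integral of its right-hand side, so relaxing initial value and integrand relaxes the flow again.
  The first iterate must exist: constant bounds need a bounded flow, and boundedness comes from
  continuity in the parameters, which has to be derived from the local Lipschitz property. The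
  relaxed dynamics are globally Lipschitz in the states, so the iteration converges on the whole
  time interval; the original dynamics are only locally Lipschitz and must first be
  truncated.\<close>

lemma integral_eq_scaled_unit_integral:
  fixes h :: "real \<Rightarrow> 'e::banach"
  assumes "continuous_on {a..t} h" "a \<le> t"
  shows "integral {a..t} h = (t - a) *\<^sub>R integral {0..1} (\<lambda>r. h ((t - a) * r + a))"
proof (cases "a = t")
  case False
  with assms have "a < t" by simp
  have "(h has_integral integral {a..t} h) (cbox a t)"
    using assms by (simp add: integrable_continuous_real integrable_integral)
  then have "((\<lambda>r. h ((t - a) *\<^sub>R r + a)) has_integral integral {a..t} h /\<^sub>R (t - a) ^ DIM(real))
      (cbox ((a - a) /\<^sub>R (t - a)) ((t - a) /\<^sub>R (t - a)))"
    using \<open>a < t\<close> by (intro has_integral_affinity') auto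
  then have "integral {0..1} (\<lambda>r. h ((t - a) * r + a)) = integral {a..t} h /\<^sub>R (t - a)"
    using \<open>a < t\<close> by (simp add: integral_unique)
  then show ?thesis using \<open>a < t\<close> by simp
qed simp

text \<open>The substitution s = (t - a) * r + a freezes the domain of integration to the unit
  interval. The end point \<open>t\<close> thereby becomes one more parameter of the integrand, and
  continuity of integrals over a fixed box applies to the pair.\<close>

lemma continuous_on_indefinite_integral_param:
  fixes h :: "real \<times> 'k::topological_space \<Rightarrow> 'e::banach"
  assumes h: "continuous_on ({a..b} \<times> K) h"
  shows "continuous_on ({a..b} \<times> K) (\<lambda>(t, k). integral {a..t} (\<lambda>s. h (s, k)))"
proof -
  have mem: "(t - a) * r + a \<in> {a..b}" if "t \<in> {a..b}" "r \<in> {0..1}" for t r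
  proof -
    have "0 \<le> (t - a) * r" "(t - a) * r \<le> t - a"
      using that by (auto intro: mult_nonneg_nonneg mult_left_le)
    then show ?thesis using that by auto
  qed
  have "continuous_on (({a..b} \<times> K) \<times> cbox 0 1)
      (\<lambda>z. h ((fst (fst z) - a) * snd z + a, snd (fst z)))"
    using mem by (intro continuous_on_compose2[OF h] continuous_intros) auto
  then have "continuous_on ({a..b} \<times> K)
      (\<lambda>z. integral (cbox 0 1) ((\<lambda>z r. h ((fst z - a) * r + a, snd z)) z))"
    by (intro integral_continuous_on_param) (simp add: split_beta)
  then have "continuous_on ({a..b} \<times> K)
      (\<lambda>z. (fst z - a) *\<^sub>R integral {0..1} (\<lambda>r. h ((fst z - a) * r + a, snd z)))"
    by (intro continuous_intros) simp
  moreover have "(case z of (t, k) \<Rightarrow> integral {a..t} (\<lambda>s. h (s, k))) =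
      (fst z - a) *\<^sub>R integral {0..1} (\<lambda>r. h ((fst z - a) * r + a, snd z))"
    if "z \<in> {a..b} \<times> K" for z
  proof -
    have "continuous_on {a..fst z} (\<lambda>s. h (s, snd z))"
      using that by (intro continuous_on_compose2[OF h] continuous_intros) auto
    from integral_eq_scaled_unit_integral[OF this] show ?thesis
      using that by (auto simp: split_beta)
  qed
  ultimately show ?thesis
    by (simp cong: continuous_on_cong)
qed

lemma solves_ivp_continuous_on:
  assumes "solves_ivp t0 tf G a u"
  shows "continuous_on {t0..tf} u"
  using assms unfolding solves_ivp_def
  by (auto simp: continuous_on_eq_continuous_within intro: has_vector_derivative_continuous)

text \<open>The gauge integral integrates every derivative, so integrability of the right-hand side
  along the solution comes together with the value. This gives the integral form of the exact flow
  with which a Picard step for the relaxations is compared.\<close>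

lemma solves_ivp_has_integral:
  fixes u :: "real \<Rightarrow> 'a::banach"
  assumes u: "solves_ivp t0 tf G a u" and t: "t \<in> {t0..tf}"
  shows "((\<lambda>s. G s (u s)) has_integral u t - a) {t0..t}"
proof -
  have "((\<lambda>s. G s (u s)) has_integral u t - u t0) {t0..t}"
  proof (rule fundamental_theorem_of_calculus)
    fix s assume "s \<in> {t0..t}"
    then have "(u has_vector_derivative G s (u s)) (at s within {t0..tf})"
      using u t unfolding solves_ivp_def by auto
    then show "(u has_vector_derivative G s (u s)) (at s within {t0..t})"
      by (rule has_vector_derivative_within_subset) (use t in auto)
  qed (use t in auto)
  with u show ?thesis by (simp add: solves_ivp_def)
qed

text \<open>The parameter \<open>k\<close> is carried along inside one operator instead of being
  frozen, because joint continuity of the iterates in time and parameter has to be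
  preserved.\<close>

definition picard ::
  "real \<Rightarrow> (real \<times> 'k \<times> 'e \<Rightarrow> 'e) \<Rightarrow> ('k \<Rightarrow> 'e) \<Rightarrow> (real \<times> 'k \<Rightarrow> 'e) \<Rightarrow> real \<times> 'k \<Rightarrow> 'e::banach" where
  "picard t0 F y0 \<phi> = (\<lambda>(t, k). y0 k + integral {t0..t} (\<lambda>s. F (s, k, \<phi> (s, k))))"

text \<open>Instantiated twice: with the truncated original dynamics, to get continuity of the flow
  in the parameters, and with the coupled relaxed dynamics, whose state is a pair of vectors. The
  Lipschitz bound is global in the state, while the parameters enter only continuously.\<close>

locale parametric_ivp =
  fixes t0 tf :: real and K :: "'k::metric_space set" and F :: "real \<times> 'k \<times> 'e::banach \<Rightarrow> 'e"
    and y0 :: "'k \<Rightarrow> 'e" and L :: real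
  assumes compact_K: "compact K"
    and continuous_F: "continuous_on ({t0..tf} \<times> K \<times> UNIV) F"
    and continuous_y0: "continuous_on K y0"
    and L_pos: "0 < L"
    and lipschitz_F: "\<And>t k y z. t \<in> {t0..tf} \<Longrightarrow> k \<in> K \<Longrightarrow>
      norm (F (t, k, y) - F (t, k, z)) \<le> L * norm (y - z)"
begin

abbreviation "D \<equiv> {t0..tf} \<times> K"
abbreviation "T \<equiv> picard t0 F y0"

lemma continuous_on_F_comp:
  assumes "k \<in> K" "continuous_on {t0..tf} u" "t \<le> tf"
  shows "continuous_on {t0..t} (\<lambda>s. F (s, k, u s))"
  using assms
  by (intro continuous_on_compose2[OF continuous_F] continuous_intros
      continuous_on_subset[OF assms(2)]) auto

lemma continuous_on_section:
  assumes "continuous_on D \<phi>" "k \<in> K"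
  shows "continuous_on {t0..tf} (\<lambda>s. \<phi> (s, k))"
  using assms by (intro continuous_on_compose2[OF assms(1)] continuous_intros) auto

lemma continuous_on_picard:
  assumes "continuous_on D \<phi>"
  shows "continuous_on D (T \<phi>)"
proof -
  have "continuous_on D (\<lambda>(s, k). F (s, k, \<phi> (s, k)))"
    unfolding split_beta
    by (intro continuous_on_compose2[OF continuous_F] continuous_on_compose2[OF assms]
        continuous_intros) auto
  from continuous_on_indefinite_integral_param[OF this]
  have "continuous_on D (\<lambda>z. integral {t0..fst z} (\<lambda>s. F (s, snd z, \<phi> (s, snd z))))"
    by (simp add: split_beta)
  then show ?thesis
    unfolding picard_def split_beta
    by (intro continuous_intros continuous_on_compose2[OF continuous_y0]) auto
qed

text \<open>The exponential weight makes the Picard operator a contraction on all of \<open>{t0..tf}\<close>.\<close>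

lemma integral_contraction:
  assumes k: "k \<in> K" and u: "continuous_on {t0..tf} u" and v: "continuous_on {t0..tf} v"
    and le: "\<And>t. t \<in> {t0..tf} \<Longrightarrow> norm (u t - v t) \<le> C * exp (2 * L * (t - t0))"
    and t: "t \<in> {t0..tf}"
  shows "norm (integral {t0..t} (\<lambda>s. F (s, k, u s)) - integral {t0..t} (\<lambda>s. F (s, k, v s)))
    \<le> C / 2 * exp (2 * L * (t - t0))"
proof -
  have C: "0 \<le> C"
    using order_trans[OF norm_ge_zero le[of t0]] t by simp
  have int: "(\<lambda>s. F (s, k, w s)) integrable_on {t0..t}" if "continuous_on {t0..tf} w" for w
    using continuous_on_F_comp[OF k that] t by (auto intro: integrable_continuous_real)
  \<comment> \<open>The rate 2 * L of the weight is twice the Lipschitz constant, so integrating L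
    times the weight leaves the factor L / (2 * L) = 1/2.\<close>
  have exp_int: "((\<lambda>s. L * (C * exp (2 * L * (s - t0)))) has_integral
      C / 2 * exp (2 * L * (t - t0)) - C / 2 * exp (2 * L * (t0 - t0))) {t0..t}"
    using t by (intro fundamental_theorem_of_calculus)
      (auto simp flip: has_real_derivative_iff_has_vector_derivative
        intro!: derivative_eq_intros)
  have "integral {t0..t} (\<lambda>s. F (s, k, u s)) - integral {t0..t} (\<lambda>s. F (s, k, v s))
      = integral {t0..t} (\<lambda>s. F (s, k, u s) - F (s, k, v s))"
    using int u v by (simp add: Henstock_Kurzweil_Integration.integral_diff)
  also have "norm \<dots> \<le> integral {t0..t} (\<lambda>s. L * (C * exp (2 * L * (s - t0))))"
  proof (rule integral_norm_bound_integral)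
    show "(\<lambda>s. F (s, k, u s) - F (s, k, v s)) integrable_on {t0..t}"
      using int u v by (intro integrable_diff) auto
    show "(\<lambda>s. L * (C * exp (2 * L * (s - t0)))) integrable_on {t0..t}"
      using exp_int by blast
    fix s assume s: "s \<in> {t0..t}"
    then have "norm (F (s, k, u s) - F (s, k, v s)) \<le> L * norm (u s - v s)"
      using t k by (intro lipschitz_F) auto
    also have "\<dots> \<le> L * (C * exp (2 * L * (s - t0)))"
      using s t L_pos by (intro mult_left_mono le) auto
    finally show "norm (F (s, k, u s) - F (s, k, v s)) \<le> L * (C * exp (2 * L * (s - t0)))" .
  qed
  also have "\<dots> = C / 2 * exp (2 * L * (t - t0)) - C / 2"
    by (subst integral_unique[OF exp_int]) simp
  also have "\<dots> \<le> C / 2 * exp (2 * L * (t - t0))"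
    using C by simp
  finally show ?thesis .
qed

lemma picard_contraction:
  assumes "continuous_on D \<phi>" "continuous_on D \<psi>"
    and "\<And>t k. t \<in> {t0..tf} \<Longrightarrow> k \<in> K \<Longrightarrow>
      norm (\<phi> (t, k) - \<psi> (t, k)) \<le> C * exp (2 * L * (t - t0))"
    and "t \<in> {t0..tf}" "k \<in> K"
  shows "norm (T \<phi> (t, k) - T \<psi> (t, k)) \<le> C / 2 * exp (2 * L * (t - t0))"
proof -
  have eq: "T \<phi> (t, k) - T \<psi> (t, k) =
      integral {t0..t} (\<lambda>s. F (s, k, \<phi> (s, k))) - integral {t0..t} (\<lambda>s. F (s, k, \<psi> (s, k)))"
    unfolding picard_def prod.case by (rule add_diff_cancel_left)
  show ?thesis
    unfolding eq
    by (rule integral_contraction[where u = "\<lambda>s. \<phi> (s, k)" and v = "\<lambda>s. \<psi> (s, k)"])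
      (rule assms continuous_on_section | assumption)+
qed

lemma solves_ivp_integral_eq:
  assumes "solves_ivp t0 tf (\<lambda>t y. F (t, k, y)) (y0 k) u" "t \<in> {t0..tf}"
  shows "u t = y0 k + integral {t0..t} (\<lambda>s. F (s, k, u s))"
  using integral_unique[OF solves_ivp_has_integral[OF assms]] by simp

lemma solves_ivp_if_integral_eq:
  assumes k: "k \<in> K" and le: "t0 \<le> tf" and cont: "continuous_on {t0..tf} u"
    and eq: "\<And>t. t \<in> {t0..tf} \<Longrightarrow> u t = y0 k + integral {t0..t} (\<lambda>s. F (s, k, u s))"
  shows "solves_ivp t0 tf (\<lambda>t y. F (t, k, y)) (y0 k) u"
  unfolding solves_ivp_def
proof (intro conjI ballI)
  show "u t0 = y0 k" using eq[of t0] le by simp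
  fix t assume t: "t \<in> {t0..tf}"
  have "((\<lambda>t. y0 k + integral {t0..t} (\<lambda>s. F (s, k, u s))) has_vector_derivative F (t, k, u t))
      (at t within {t0..tf})"
    using integral_has_vector_derivative[OF continuous_on_F_comp[OF k cont order_refl] t]
    by (auto intro!: derivative_eq_intros)
  then show "(u has_vector_derivative F (t, k, u t)) (at t within {t0..tf})"
    by (rule has_vector_derivative_transform[rotated 2]) (use t eq in auto)
qed

text \<open>Both functions are fixed by the integral operator, so any weighted bound on their
  distance may be halved. Starting from a plain bound \<open>C\<close>, repeated halving forces the
  distance to zero.\<close>

lemma solves_ivp_unique:
  assumes k: "k \<in> K" and u: "solves_ivp t0 tf (\<lambda>t y. F (t, k, y)) (y0 k) u"
    and v: "solves_ivp t0 tf (\<lambda>t y. F (t, k, y)) (y0 k) v" and t: "t \<in> {t0..tf}"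
  shows "u t = v t"
proof -
  have cu: "continuous_on {t0..tf} u" and cv: "continuous_on {t0..tf} v"
    using u v by (auto intro: solves_ivp_continuous_on)
  have "compact ((\<lambda>t. norm (u t - v t)) ` {t0..tf})"
    using cu cv by (intro compact_continuous_image continuous_intros) auto
  then obtain C where C: "\<And>t. t \<in> {t0..tf} \<Longrightarrow> norm (u t - v t) \<le> C"
    by (force dest!: compact_imp_bounded simp: bounded_iff)
  have C0: "0 \<le> C" using C[OF t] norm_ge_zero order_trans by blast
  have bound: "norm (u t - v t) \<le> C * (1/2) ^ n * exp (2 * L * (t - t0))"
    if "t \<in> {t0..tf}" for n t
    using that
  proof (induction n arbitrary: t)
    case 0
    then have "1 \<le> exp (2 * L * (t - t0))" using L_pos by simp
    then have "C * 1 \<le> C * exp (2 * L * (t - t0))" using C0 by (intro mult_left_mono)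
    then show ?case using C[OF 0] by simp
  next
    case (Suc n)
    from integral_contraction[OF k cu cv Suc.IH Suc.prems]
    show ?case
      using solves_ivp_integral_eq[OF u Suc.prems] solves_ivp_integral_eq[OF v Suc.prems]
      by simp
  qed
  have "(\<lambda>n. C * (1/2) ^ n * exp (2 * L * (t - t0))) \<longlonglongrightarrow> C * 0 * exp (2 * L * (t - t0))"
    by (intro tendsto_intros LIMSEQ_power_zero) auto
  then have "norm (u t - v t) \<le> C * 0 * exp (2 * L * (t - t0))"
    by (rule LIMSEQ_le_const) (use bound[OF t] in blast)
  then show ?thesis by simp
qed

text \<open>Successive differences shrink geometrically in the weighted norm, so their telescoping
  series converges uniformly and its sum is jointly continuous. Convergence of the iterates belongs
  to the conclusion because properties of the iterates are later passed to the solution through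
  it.\<close>

lemma picard_limit:
  assumes "t0 \<le> tf" and \<phi>: "continuous_on D \<phi>"
  shows "\<exists>y. continuous_on D y \<and> (\<forall>z\<in>D. (\<lambda>n. (T ^^ n) \<phi> z) \<longlonglongrightarrow> y z) \<and>
    (\<forall>k\<in>K. unique_ivp_solution t0 tf (\<lambda>t y. F (t, k, y)) (y0 k) (\<lambda>t. y (t, k)))"
proof -
  have cont: "continuous_on D ((T ^^ n) \<phi>)" for n
    by (induction n) (auto simp: \<phi> continuous_on_picard)
  have "compact ((\<lambda>z. norm (T \<phi> z - \<phi> z)) ` D)"
    by (intro compact_continuous_image continuous_on_norm continuous_on_diff
        continuous_on_picard \<phi> compact_Times compact_Icc compact_K)
  then obtain C' where C': "\<And>z. z \<in> D \<Longrightarrow> norm (T \<phi> z - \<phi> z) \<le> C'"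
    by (force dest!: compact_imp_bounded simp: bounded_iff)
  define C where "C = max C' 0"
  have C: "norm (T \<phi> z - \<phi> z) \<le> C" if "z \<in> D" for z
    using C'[OF that] by (simp add: C_def)
  have C0: "0 \<le> C" by (simp add: C_def)
  have exp_ge: "c \<le> c * exp (2 * L * (t - t0))" if "0 \<le> c" "t \<in> {t0..tf}" for c t
  proof -
    have "1 \<le> exp (2 * L * (t - t0))" using L_pos that by simp
    then have "c * 1 \<le> c * exp (2 * L * (t - t0))" using that by (intro mult_left_mono)
    then show ?thesis by simp
  qed
  have step: "norm ((T ^^ Suc n) \<phi> (t, k) - (T ^^ n) \<phi> (t, k))
      \<le> C * (1/2) ^ n * exp (2 * L * (t - t0))" if "t \<in> {t0..tf}" "k \<in> K" for n t k
    using that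
  proof (induction n arbitrary: t k)
    case 0
    then show ?case using C[of "(t, k)"] exp_ge[OF C0, of t] by simp
  next
    case (Suc n)
    from picard_contraction[OF cont cont Suc.IH Suc.prems]
    show ?case by simp
  qed
  \<comment> \<open>The largest value of the weight on the interval; it converts weighted bounds
    into uniform ones.\<close>
  define E where "E = exp (2 * L * (tf - t0))"
  have "uniformly_convergent_on D (\<lambda>n z. \<Sum>i<n. (T ^^ Suc i) \<phi> z - (T ^^ i) \<phi> z)"
  proof (rule Weierstrass_m_test')
    fix n z assume "z \<in> D"
    then obtain t k where z: "z = (t, k)" "t \<in> {t0..tf}" "k \<in> K" by auto
    have "exp (2 * L * (t - t0)) \<le> E"
      using z L_pos by (simp add: E_def)
    then have "C * (1/2) ^ n * exp (2 * L * (t - t0)) \<le> C * (1/2) ^ n * E"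
      using C0 by (intro mult_left_mono) auto
    then show "norm ((T ^^ Suc n) \<phi> z - (T ^^ n) \<phi> z) \<le> C * (1/2) ^ n * E"
      using step[of t k n] z by simp
  next
    show "summable (\<lambda>n. C * (1/2) ^ n * E)"
      by (intro summable_mult summable_mult2 summable_geometric) auto
  qed
  then obtain l where "uniform_limit D (\<lambda>n z. \<Sum>i<n. (T ^^ Suc i) \<phi> z - (T ^^ i) \<phi> z) l sequentially"
    unfolding uniformly_convergent_on_def by blast
  then have "uniform_limit D (\<lambda>n z. (T ^^ n) \<phi> z - \<phi> z) l sequentially"
    by (subst (asm) sum_lessThan_telescope) simp
  then have "uniform_limit D (\<lambda>n z. ((T ^^ n) \<phi> z - \<phi> z) + \<phi> z) (\<lambda>z. l z + \<phi> z) sequentially"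
    by (rule uniform_limit_add[OF _ uniform_limit_const])
  then have ul: "uniform_limit D (\<lambda>n. (T ^^ n) \<phi>) (\<lambda>z. l z + \<phi> z) sequentially"
    by simp
  define y where "y = (\<lambda>z. l z + \<phi> z)"
  note ul = ul[folded y_def]
  have cy: "continuous_on D y"
    using cont by (intro uniform_limit_theorem[OF _ ul]) auto
  have lim: "(\<lambda>n. (T ^^ n) \<phi> z) \<longlonglongrightarrow> y z" if "z \<in> D" for z
    using ul that by (rule tendsto_uniform_limitI)
  have fixed: "T y (t, k) = y (t, k)" if tk: "t \<in> {t0..tf}" "k \<in> K" for t k
  proof -
    have "(\<lambda>n. T ((T ^^ n) \<phi>) (t, k)) \<longlonglongrightarrow> T y (t, k)"
    proof (rule LIMSEQ_I)
      fix e :: real assume "0 < e"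
      \<comment> \<open>A uniform error below e / E becomes, after one contraction and after
        bounding the weight by \<open>E\<close>, an error of at most e / 2.\<close>
      then have "0 < e / E" by (simp add: E_def)
      from uniform_limitD[OF ul this] obtain N where
        N: "\<And>n z. n \<ge> N \<Longrightarrow> z \<in> D \<Longrightarrow> dist ((T ^^ n) \<phi> z) (y z) < e / E"
        unfolding eventually_sequentially by blast
      show "\<exists>N. \<forall>n\<ge>N. norm (T ((T ^^ n) \<phi>) (t, k) - T y (t, k)) < e"
      proof (intro exI allI impI)
        fix n assume "N \<le> n"
        have "norm (T ((T ^^ n) \<phi>) (t, k) - T y (t, k)) \<le> (e / E) / 2 * exp (2 * L * (t - t0))"
        proof (rule picard_contraction[OF cont cy _ tk])
          fix t k assume "t \<in> {t0..tf}" "k \<in> K"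
          then show "norm ((T ^^ n) \<phi> (t, k) - y (t, k)) \<le> e / E * exp (2 * L * (t - t0))"
            using N[OF \<open>N \<le> n\<close>, of "(t, k)"] exp_ge[of "e / E" t] \<open>0 < e / E\<close>
            by (simp add: dist_norm)
        qed
        also have "\<dots> \<le> (e / E) / 2 * E"
          using tk L_pos \<open>0 < e / E\<close> by (intro mult_left_mono) (auto simp: E_def)
        also have "\<dots> < e" using \<open>0 < e\<close> by (simp add: E_def)
        finally show "norm (T ((T ^^ n) \<phi>) (t, k) - T y (t, k)) < e" .
      qed
    qed
    moreover have "(\<lambda>n. T ((T ^^ n) \<phi>) (t, k)) \<longlonglongrightarrow> y (t, k)"
      using LIMSEQ_Suc[OF lim[of "(t, k)"]] tk by simp
    ultimately show ?thesis by (rule LIMSEQ_unique)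
  qed
  have "unique_ivp_solution t0 tf (\<lambda>t y. F (t, k, y)) (y0 k) (\<lambda>t. y (t, k))" if k: "k \<in> K" for k
  proof -
    have "solves_ivp t0 tf (\<lambda>t y. F (t, k, y)) (y0 k) (\<lambda>t. y (t, k))"
    proof (rule solves_ivp_if_integral_eq[OF k assms(1) continuous_on_section[OF cy k]])
      fix t assume "t \<in> {t0..tf}"
      from fixed[OF this k]
      show "y (t, k) = y0 k + integral {t0..t} (\<lambda>s. F (s, k, y (s, k)))"
        by (simp only: picard_def prod.case)
    qed
    then show ?thesis
      unfolding unique_ivp_solution_def using solves_ivp_unique[OF k] by blast
  qed
  with cy lim show ?thesis by blast
qed

end

section \<open>Continuous dependence on parameters\<close>

text \<open>A one-point dummy time set turns the joint estimate into an instance of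
  \<open>local_lipschitz\<close>, for which compactness yields a single constant. Halving the radius
  fits the closed ball into the open one.\<close>

lemma locally_lipschitz_imp_lipschitz_on_compact:
  assumes "locally_lipschitz h" "compact X"
  obtains L where "L-lipschitz_on X h"
proof -
  have "local_lipschitz {0::real} X (\<lambda>_. h)"
  proof (rule local_lipschitzI)
    fix t :: real and s assume "s \<in> X"
    obtain u L where u: "u > 0" "L-lipschitz_on (ball s u) h"
      using assms(1) unfolding locally_lipschitz_def by blast
    then have "L-lipschitz_on (cball s (u / 2) \<inter> X) h"
      by (intro lipschitz_on_subset[OF u(2)]) auto
    then show "\<exists>u>0. \<exists>L. \<forall>t\<in>cball t u \<inter> {0}. L-lipschitz_on (cball s u \<inter> X) h"
      using u(1) by (intro exI[of _ "u / 2"]) auto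
  qed
  then obtain L where "\<And>t. t \<in> {0::real} \<Longrightarrow> L-lipschitz_on X h"
    by (rule local_lipschitz_compact_implies_lipschitz[OF _ assms(2)]) auto
  then show ?thesis using that by blast
qed

lemma locally_lipschitz_imp_continuous_on:
  assumes "locally_lipschitz h"
  shows "continuous_on S h"
proof (rule continuous_at_imp_continuous_on, rule ballI)
  fix s
  obtain u L where u: "u > 0" "L-lipschitz_on (ball s u) h"
    using assms unfolding locally_lipschitz_def by blast
  then show "isCont h s"
    using continuous_on_interior[OF lipschitz_on_continuous_on[OF u(2)], of s] by simp
qed

text \<open>Truncating the right-hand side outside a unit tube around the reference solution makes it
  globally Lipschitz, so Picard iteration yields a continuous family of solutions; by uniqueness it
  agrees with the original family wherever it stays inside the tube.\<close>

lemma unique_ivp_solution_continuous_on: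
  fixes F :: "real \<times> 'k::metric_space \<times> 'e::euclidean_space \<Rightarrow> 'e"
  assumes le: "t0 \<le> tf" and K: "compact K" and y0: "continuous_on K y0"
    and F: "continuous_on ({t0..tf} \<times> K \<times> UNIV) F"
    and lip: "\<And>r. \<exists>L. \<forall>t\<in>{t0..tf}. \<forall>k\<in>K. L-lipschitz_on (cball 0 r) (\<lambda>y. F (t, k, y))"
    and sol: "\<And>k. k \<in> K \<Longrightarrow> unique_ivp_solution t0 tf (\<lambda>t y. F (t, k, y)) (y0 k) (\<lambda>t. x t k)"
  shows "continuous_on ({t0..tf} \<times> K) (\<lambda>(t, k). x t k)"
  unfolding continuous_on_eq_continuous_within
proof
  fix z assume "z \<in> {t0..tf} \<times> K"
  then obtain t1 k0 where z: "z = (t1, k0)" "t1 \<in> {t0..tf}" and k0: "k0 \<in> K" by auto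
  define u where "u = (\<lambda>t. x t k0)"
  have u_sol: "solves_ivp t0 tf (\<lambda>t y. F (t, k0, y)) (y0 k0) u"
    using sol[OF k0] unfolding u_def unique_ivp_solution_def by blast
  have cu: "continuous_on {t0..tf} u"
    by (rule solves_ivp_continuous_on[OF u_sol])
  then have "bounded (u ` {t0..tf})"
    by (intro compact_imp_bounded compact_continuous_image) auto
  then obtain R where R: "\<And>t. t \<in> {t0..tf} \<Longrightarrow> norm (u t) \<le> R"
    by (force simp: bounded_iff)
  \<comment> \<open>The nearest-point projection onto the unit ball: a 1-Lipschitz map that fixes
    the ball, hence a truncation that does not spoil Lipschitz constants.\<close>
  define c where "c = closest_point (cball (0::'e) 1)"
  have c_in: "norm (c y) \<le> 1" for y
    using closest_point_in_set[of "cball (0::'e) 1" y] by (simp add: c_def)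
  have c_self: "c y = y" if "norm y \<le> 1" for y
    using that by (simp add: c_def closest_point_self)
  have c_lip: "norm (c y - c z) \<le> norm (y - z)" for y z
    using closest_point_lipschitz[of "cball (0::'e) 1" y z] by (simp add: c_def dist_norm)
  have c_cont: "continuous_on UNIV c"
    unfolding c_def by (intro continuous_on_closest_point) auto
  \<comment> \<open>The state handed to \<open>F\<close> always lies within distance 1 of
    \<open>u t\<close>, hence in the ball of radius R + 1, where one constant \<open>L\<close> works
    for all times and parameters. Inside the tube \<open>G\<close> coincides with
    \<open>F\<close>.\<close>
  define G where "G = (\<lambda>(t, k, y). F (t, k, u t + c (y - u t)))"
  obtain L where L: "\<And>t k. t \<in> {t0..tf} \<Longrightarrow> k \<in> K \<Longrightarrow> L-lipschitz_on (cball 0 (R + 1)) (\<lambda>y. F (t, k, y))"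
    using lip[of "R + 1"] by blast
  have ball: "u t + c y \<in> cball 0 (R + 1)" if "t \<in> {t0..tf}" for t y
    using norm_triangle_ineq[of "u t" "c y"] R[OF that] c_in[of y] by simp
  interpret parametric_ivp t0 tf K G y0 "\<bar>L\<bar> + 1"
  proof
    show "continuous_on ({t0..tf} \<times> K \<times> UNIV) G"
      unfolding G_def split_beta
      by (intro continuous_on_compose2[OF F] continuous_on_compose2[OF c_cont]
          continuous_on_compose2[OF cu] continuous_intros) auto
    fix t k y z assume tk: "t \<in> {t0..tf}" "k \<in> K"
    have "norm (G (t, k, y) - G (t, k, z)) \<le> L * norm (c (y - u t) - c (z - u t))"
      using lipschitz_onD[OF L[OF tk] ball[OF tk(1), of "y - u t"] ball[OF tk(1), of "z - u t"]]
      by (simp add: G_def dist_norm)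
    also have "\<dots> \<le> (\<bar>L\<bar> + 1) * norm (y - z)"
      using c_lip[of "y - u t" "z - u t"] by (intro mult_mono) auto
    finally show "norm (G (t, k, y) - G (t, k, z)) \<le> (\<bar>L\<bar> + 1) * norm (y - z)" .
  qed (use K y0 in auto)
  obtain y where cy: "continuous_on D y"
    and y: "\<And>k. k \<in> K \<Longrightarrow> unique_ivp_solution t0 tf (\<lambda>t y. G (t, k, y)) (y0 k) (\<lambda>t. y (t, k))"
    using picard_limit[OF le continuous_on_const[where c = 0]] by blast
  have "solves_ivp t0 tf (\<lambda>t y. G (t, k0, y)) (y0 k0) u"
    using u_sol c_self[of 0] by (simp add: solves_ivp_def G_def)
  then have yu: "y (t, k0) = u t" if "t \<in> {t0..tf}" for t
    using y[OF k0] that unfolding unique_ivp_solution_def by auto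
  \<comment> \<open>Uniformity in time matters: the truncation must be inactive along the entire
    trajectory before uniqueness can identify it with the original solution.\<close>
  have "uniformly_continuous_on D y"
    using cy K by (intro compact_uniformly_continuous compact_Times) auto
  then obtain d where d: "d > 0" "\<And>z z'. z \<in> D \<Longrightarrow> z' \<in> D \<Longrightarrow> dist z' z < d \<Longrightarrow> dist (y z') (y z) < 1"
    unfolding uniformly_continuous_on_def by (metis zero_less_one)
  have eq: "y (t, k) = x t k" if k: "k \<in> K" "dist k k0 < d" and t: "t \<in> {t0..tf}" for t k
  proof -
    have "c (y (s, k) - u s) = y (s, k) - u s" if "s \<in> {t0..tf}" for s
      using d(2)[of "(s, k0)" "(s, k)"] k k0 that yu[OF that]
      by (intro c_self) (simp add: dist_Pair_Pair dist_norm)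
    then have "solves_ivp t0 tf (\<lambda>t y. F (t, k, y)) (y0 k) (\<lambda>t. y (t, k))"
      using y[OF k(1)] unfolding unique_ivp_solution_def solves_ivp_def G_def by auto
    then show ?thesis
      using sol[OF k(1)] t unfolding unique_ivp_solution_def by auto
  qed
  show "continuous (at z within {t0..tf} \<times> K) (\<lambda>(t, k). x t k)"
  proof (rule continuous_transform_within[OF _ d(1)])
    show "continuous (at z within D) y"
      using cy z k0 by (auto simp: continuous_on_eq_continuous_within)
    show "z \<in> D" using z k0 by simp
    fix z' assume "z' \<in> D" "dist z' z < d"
    then show "y z' = (case z' of (t, k) \<Rightarrow> x t k)"
      using eq z dist_snd_le[of z' z] by (auto intro!: eq)
  qed
qed

section \<open>Relaxations\<close>

lemma concave_relaxation_on_iff: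
  "concave_relaxation_on S h c \<longleftrightarrow> convex_relaxation_on S (\<lambda>s. - h s) (\<lambda>s. - c s)"
  by (simp add: concave_relaxation_on_def convex_relaxation_on_def concave_on_def)

lemma convex_relaxation_on_cong:
  assumes "\<And>s. s \<in> S \<Longrightarrow> h s = h' s" "\<And>s. s \<in> S \<Longrightarrow> c s = c' s"
  shows "convex_relaxation_on S h c \<longleftrightarrow> convex_relaxation_on S h' c'"
proof -
  have "convex_on S c \<longleftrightarrow> convex_on S c'"
    unfolding convex_on_def using assms(2) by (auto simp: convex_def)
  with assms show ?thesis by (simp add: convex_relaxation_on_def)
qed

text \<open>Convexity and the bound are families of non-strict inequalities between values at
  finitely many points, so they survive pointwise limits.\<close>

lemma convex_relaxation_on_LIMSEQ:
  assumes c: "\<And>n. convex_relaxation_on S h (c n)" and lim: "\<And>s. s \<in> S \<Longrightarrow> (\<lambda>n. c n s) \<longlonglongrightarrow> l s"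
  shows "convex_relaxation_on S h l"
  unfolding convex_relaxation_on_def
proof (intro conjI ballI)
  show "convex_on S l"
  proof (rule convex_onI)
    show "convex S"
      using c by (auto simp: convex_relaxation_on_def convex_on_def)
    fix t :: real and x y assume t: "0 < t" "t < 1" and xy: "x \<in> S" "y \<in> S"
    then have "(1 - t) *\<^sub>R x + t *\<^sub>R y \<in> S"
      using \<open>convex S\<close> by (auto intro: convexD_alt)
    moreover have "c n ((1 - t) *\<^sub>R x + t *\<^sub>R y) \<le> (1 - t) * c n x + t * c n y" for n
      using c[of n] t xy by (auto simp: convex_relaxation_on_def intro: convex_onD)
    ultimately show "l ((1 - t) *\<^sub>R x + t *\<^sub>R y) \<le> (1 - t) * l x + t * l y"
      using xy by (intro LIMSEQ_le[OF lim tendsto_add[OF tendsto_mult_left[OF lim] tendsto_mult_left[OF lim]]])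
        auto
  qed
  fix s assume "s \<in> S"
  then show "l s \<le> h s"
    using c by (intro LIMSEQ_le_const2[OF lim]) (auto simp: convex_relaxation_on_def)
qed

text \<open>The abstract form of one Picard step. Integration over time is linear and monotone, so
  it carries the convexity inequality and the bound from each time to the integral.\<close>

lemma convex_relaxation_on_add_integral:
  fixes a b :: real
  assumes 0: "convex_relaxation_on S h0 c0"
    and le: "\<And>\<tau>. \<tau> \<in> {a..b} \<Longrightarrow> convex_relaxation_on S (h \<tau>) (c \<tau>)"
    and h: "\<And>s. s \<in> S \<Longrightarrow> (\<lambda>\<tau>. h \<tau> s) integrable_on {a..b}"
    and c: "\<And>s. s \<in> S \<Longrightarrow> (\<lambda>\<tau>. c \<tau> s) integrable_on {a..b}"
  shows "convex_relaxation_on S (\<lambda>s. h0 s + integral {a..b} (\<lambda>\<tau>. h \<tau> s))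
    (\<lambda>s. c0 s + integral {a..b} (\<lambda>\<tau>. c \<tau> s))"
  unfolding convex_relaxation_on_def
proof (intro conjI ballI)
  have S: "convex S" using 0 by (auto simp: convex_relaxation_on_def convex_on_def)
  have "convex_on S (\<lambda>s. integral {a..b} (\<lambda>\<tau>. c \<tau> s))"
  proof (rule convex_onI[OF _ S])
    fix t :: real and x y assume t: "0 < t" "t < 1" and xy: "x \<in> S" "y \<in> S"
    have "c \<tau> ((1 - t) *\<^sub>R x + t *\<^sub>R y) \<le> (1 - t) * c \<tau> x + t * c \<tau> y" if "\<tau> \<in> {a..b}" for \<tau>
      using le[OF that] t xy by (auto simp: convex_relaxation_on_def intro: convex_onD)
    moreover have "(1 - t) *\<^sub>R x + t *\<^sub>R y \<in> S"
      using t xy S by (auto intro: convexD_alt)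
    ultimately have "integral {a..b} (\<lambda>\<tau>. c \<tau> ((1 - t) *\<^sub>R x + t *\<^sub>R y))
        \<le> integral {a..b} (\<lambda>\<tau>. (1 - t) * c \<tau> x + t * c \<tau> y)"
      using xy by (intro integral_le c integrable_add integrable_on_mult_right)
    also have "\<dots> = (1 - t) * integral {a..b} (\<lambda>\<tau>. c \<tau> x) + t * integral {a..b} (\<lambda>\<tau>. c \<tau> y)"
      using c[OF xy(1)] c[OF xy(2)]
      by (subst Henstock_Kurzweil_Integration.integral_add) (auto intro: integrable_on_mult_right)
    finally show "integral {a..b} (\<lambda>\<tau>. c \<tau> ((1 - t) *\<^sub>R x + t *\<^sub>R y))
      \<le> (1 - t) * integral {a..b} (\<lambda>\<tau>. c \<tau> x) + t * integral {a..b} (\<lambda>\<tau>. c \<tau> y)" .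
  qed
  then show "convex_on S (\<lambda>s. c0 s + integral {a..b} (\<lambda>\<tau>. c \<tau> s))"
    using 0 by (intro convex_on_add) (auto simp: convex_relaxation_on_def)
  fix s assume "s \<in> S"
  then show "c0 s + integral {a..b} (\<lambda>\<tau>. c \<tau> s) \<le> h0 s + integral {a..b} (\<lambda>\<tau>. h \<tau> s)"
    using 0 le by (intro add_mono integral_le h c) (auto simp: convex_relaxation_on_def)
qed

section \<open>Vector-valued relaxations, componentwise and up to sign\<close>

lemma vec_convex_relaxation_on_LIMSEQ:
  assumes "\<And>n. vec_convex_relaxation_on S h (c n)" "\<And>s. s \<in> S \<Longrightarrow> (\<lambda>n. c n s) \<longlonglongrightarrow> l s"
  shows "vec_convex_relaxation_on S h l"
  unfolding vec_convex_relaxation_on_def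
proof
  fix j
  have "convex_relaxation_on S (\<lambda>s. h s $ j) (\<lambda>s. c n s $ j)" for n
    using assms(1) by (simp add: vec_convex_relaxation_on_def)
  then show "convex_relaxation_on S (\<lambda>s. h s $ j) (\<lambda>s. l s $ j)"
    by (rule convex_relaxation_on_LIMSEQ) (rule tendsto_vec_nth[OF assms(2)])
qed

lemma vec_convex_relaxation_on_cong:
  assumes "\<And>s. s \<in> S \<Longrightarrow> h s = h' s" "\<And>s. s \<in> S \<Longrightarrow> c s = c' s"
  shows "vec_convex_relaxation_on S h c \<longleftrightarrow> vec_convex_relaxation_on S h' c'"
  unfolding vec_convex_relaxation_on_def
  using assms by (intro all_cong1 convex_relaxation_on_cong) auto

lemma vec_convex_relaxation_on_add_integral:
  fixes a b :: real and h0 :: "'a::real_vector \<Rightarrow> real^'n"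
  assumes "vec_convex_relaxation_on S h0 c0"
    and "\<And>\<tau>. \<tau> \<in> {a..b} \<Longrightarrow> vec_convex_relaxation_on S (h \<tau>) (c \<tau>)"
    and h: "\<And>s. s \<in> S \<Longrightarrow> (\<lambda>\<tau>. h \<tau> s) integrable_on {a..b}"
    and c: "\<And>s. s \<in> S \<Longrightarrow> (\<lambda>\<tau>. c \<tau> s) integrable_on {a..b}"
  shows "vec_convex_relaxation_on S (\<lambda>s. h0 s + integral {a..b} (\<lambda>\<tau>. h \<tau> s))
    (\<lambda>s. c0 s + integral {a..b} (\<lambda>\<tau>. c \<tau> s))"
  unfolding vec_convex_relaxation_on_def
proof
  fix j :: 'n
  have int: "(\<lambda>\<tau>. u \<tau> $ j) integrable_on {a..b}" if "u integrable_on {a..b}" for u :: "real \<Rightarrow> real^'n"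
    using integrable_linear[OF that bounded_linear_vec_nth[of j]] by (simp add: o_def)
  have "convex_relaxation_on S (\<lambda>s. h0 s $ j + integral {a..b} (\<lambda>\<tau>. h \<tau> s $ j))
      (\<lambda>s. c0 s $ j + integral {a..b} (\<lambda>\<tau>. c \<tau> s $ j))"
  proof (rule convex_relaxation_on_add_integral)
    show "convex_relaxation_on S (\<lambda>s. h0 s $ j) (\<lambda>s. c0 s $ j)"
      using assms(1) by (simp add: vec_convex_relaxation_on_def)
    show "convex_relaxation_on S (\<lambda>s. h \<tau> s $ j) (\<lambda>s. c \<tau> s $ j)" if "\<tau> \<in> {a..b}" for \<tau>
      using assms(2)[OF that] by (simp add: vec_convex_relaxation_on_def)
    fix s assume "s \<in> S"
    then show "(\<lambda>\<tau>. h \<tau> s $ j) integrable_on {a..b}" "(\<lambda>\<tau>. c \<tau> s $ j) integrable_on {a..b}"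
      by (rule int[OF h] int[OF c])+
  qed
  then show "convex_relaxation_on S (\<lambda>s. (h0 s + integral {a..b} (\<lambda>\<tau>. h \<tau> s)) $ j)
      (\<lambda>s. (c0 s + integral {a..b} (\<lambda>\<tau>. c \<tau> s)) $ j)"
    by (rule convex_relaxation_on_cong[THEN iffD1, rotated 2])
      (simp_all only: vector_add_component integral_component_eq_cart h c)
qed

lemma vec_concave_relaxation_on_iff:
  "vec_concave_relaxation_on S h c \<longleftrightarrow> vec_convex_relaxation_on S (\<lambda>s. - h s) (\<lambda>s. - c s)"
  by (simp add: vec_concave_relaxation_on_def vec_convex_relaxation_on_def concave_relaxation_on_iff)

lemma vec_concave_relaxation_on_cong:
  assumes "\<And>s. s \<in> S \<Longrightarrow> h s = h' s" "\<And>s. s \<in> S \<Longrightarrow> c s = c' s"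
  shows "vec_concave_relaxation_on S h c \<longleftrightarrow> vec_concave_relaxation_on S h' c'"
  unfolding vec_concave_relaxation_on_iff
  using assms by (intro vec_convex_relaxation_on_cong) auto

lemma vec_concave_relaxation_on_LIMSEQ:
  assumes "\<And>n. vec_concave_relaxation_on S h (c n)" "\<And>s. s \<in> S \<Longrightarrow> (\<lambda>n. c n s) \<longlonglongrightarrow> l s"
  shows "vec_concave_relaxation_on S h l"
  unfolding vec_concave_relaxation_on_iff
  by (rule vec_convex_relaxation_on_LIMSEQ[OF assms(1)[unfolded vec_concave_relaxation_on_iff]
      tendsto_minus[OF assms(2)]])

lemma vec_concave_relaxation_on_add_integral:
  fixes a b :: real
  assumes "vec_concave_relaxation_on S h0 c0"
    and "\<And>\<tau>. \<tau> \<in> {a..b} \<Longrightarrow> vec_concave_relaxation_on S (h \<tau>) (c \<tau>)"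
    and h: "\<And>s. s \<in> S \<Longrightarrow> (\<lambda>\<tau>. h \<tau> s) integrable_on {a..b}"
    and c: "\<And>s. s \<in> S \<Longrightarrow> (\<lambda>\<tau>. c \<tau> s) integrable_on {a..b}"
  shows "vec_concave_relaxation_on S (\<lambda>s. h0 s + integral {a..b} (\<lambda>\<tau>. h \<tau> s))
    (\<lambda>s. c0 s + integral {a..b} (\<lambda>\<tau>. c \<tau> s))"
proof -
  have "vec_convex_relaxation_on S (\<lambda>s. - h0 s + integral {a..b} (\<lambda>\<tau>. - h \<tau> s))
      (\<lambda>s. - c0 s + integral {a..b} (\<lambda>\<tau>. - c \<tau> s))"
  proof (rule vec_convex_relaxation_on_add_integral)
    show "vec_convex_relaxation_on S (\<lambda>s. - h0 s) (\<lambda>s. - c0 s)"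
      using assms(1) by (simp add: vec_concave_relaxation_on_iff)
    show "vec_convex_relaxation_on S (\<lambda>s. - h \<tau> s) (\<lambda>s. - c \<tau> s)" if "\<tau> \<in> {a..b}" for \<tau>
      using assms(2)[OF that] by (simp add: vec_concave_relaxation_on_iff)
    fix s assume "s \<in> S"
    then show "(\<lambda>\<tau>. - h \<tau> s) integrable_on {a..b}" "(\<lambda>\<tau>. - c \<tau> s) integrable_on {a..b}"
      by (rule integrable_neg[OF h] integrable_neg[OF c])+
  qed
  then show ?thesis
    by (simp add: vec_concave_relaxation_on_iff)
qed

text \<open>Provides the first Picard iterate: constants are both convex and concave, and the norm
  dominates every component.\<close>

lemma vec_relaxation_on_const:
  fixes h :: "'a::real_vector \<Rightarrow> real^'n"
  assumes "convex S" "\<And>s. s \<in> S \<Longrightarrow> norm (h s) \<le> B"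
  shows "vec_convex_relaxation_on S h (\<lambda>_. vec (- B))"
    and "vec_concave_relaxation_on S h (\<lambda>_. vec B)"
proof -
  have "- B \<le> h s $ j" "h s $ j \<le> B" if "s \<in> S" for s j
    using component_le_norm_cart[of "h s" j] assms(2)[OF that] by linarith+
  then show "vec_convex_relaxation_on S h (\<lambda>_. vec (- B))"
    and "vec_concave_relaxation_on S h (\<lambda>_. vec B)"
    using assms(1)
    by (auto simp: vec_convex_relaxation_on_def vec_concave_relaxation_on_def
        convex_relaxation_on_def concave_relaxation_on_def concave_on_def convex_on_const)
qed

text \<open>The convexity of the relaxed solutions is inherited from the Picard iterates: the iteration
  starts at constant bounds and each step preserves the relaxation property.\<close>

lemma relaxed_solutions:
  fixes x :: "real \<Rightarrow> real^'p \<Rightarrow> real^'w \<Rightarrow> real^'x"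
  assumes le: "t0 \<le> tf" and Q: "compact Q" "convex Q" and \<Theta>: "compact \<Theta>" "convex \<Theta>"
    and init: "initial_relaxations x0 Q \<Theta> x0cv x0cc"
    and dyn: "dynamics_relaxations t0 tf f x Q \<Theta> fcv fcc"
    and x_cont: "continuous_on ({t0..tf} \<times> (Q \<times> \<Theta>)) (\<lambda>(t, p, w). x t p w)"
    and x_sol: "\<And>p w. p \<in> Q \<Longrightarrow> w \<in> \<Theta> \<Longrightarrow>
      solves_ivp t0 tf (\<lambda>t y. f (t, p, w, y)) (x0 (p, w)) (\<lambda>t. x t p w)"
  obtains xcv xcc :: "real \<Rightarrow> (real^'p) \<times> (real^'w) \<Rightarrow> real^'x"
    where "\<And>p w. p \<in> Q \<Longrightarrow> w \<in> \<Theta> \<Longrightarrow> unique_relaxed_solution t0 tf fcv fcc x0cv x0cc p w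
        (\<lambda>t. xcv t (p, w)) (\<lambda>t. xcc t (p, w))"
    and "continuous_on (Q \<times> \<Theta>) (xcv tf)" "continuous_on (Q \<times> \<Theta>) (xcc tf)"
    and "vec_convex_relaxation_on (Q \<times> \<Theta>) (\<lambda>(p, w). x tf p w) (xcv tf)"
    and "vec_concave_relaxation_on (Q \<times> \<Theta>) (\<lambda>(p, w). x tf p w) (xcc tf)"
proof -
  let ?K = "Q \<times> \<Theta>" and ?I = "{t0..tf}"
  let ?x = "\<lambda>t. \<lambda>(p, w). x t p w"
  \<comment> \<open>The lower and upper equations feed into each other, so the pair is iterated as
    one state, with (p, w) as the parameter.\<close>
  define F where "F = (\<lambda>(t, (p, w), (y, z)). (fcv (t, p, w, y, z), fcc (t, p, w, y, z)))"
  define y0 where "y0 = (\<lambda>k. (x0cv k, x0cc k))"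
  obtain Lv Lc where Lv: "Lv-lipschitz_on (?I \<times> Q \<times> \<Theta> \<times> UNIV \<times> UNIV) fcv"
    and Lc: "Lc-lipschitz_on (?I \<times> Q \<times> \<Theta> \<times> UNIV \<times> UNIV) fcc"
    using dyn unfolding dynamics_relaxations_def by blast
  note cv_cont = lipschitz_on_continuous_on[OF Lv] and cc_cont = lipschitz_on_continuous_on[OF Lc]
  have nonneg: "0 \<le> Lv" "0 \<le> Lc"
    using Lv Lc by (auto simp: lipschitz_on_def)
  have K: "compact ?K" "convex ?K"
    using Q \<Theta> by (auto intro: compact_Times convex_Times)
  \<comment> \<open>The summand 1 keeps the constant strictly positive when \<open>Lv\<close> and
    \<open>Lc\<close> both vanish.\<close>
  interpret parametric_ivp t0 tf ?K F y0 "Lv + Lc + 1"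
  proof
    show "continuous_on (?I \<times> ?K \<times> UNIV) F"
      unfolding F_def split_beta
      by (intro continuous_on_Pair continuous_on_compose2[OF cv_cont]
          continuous_on_compose2[OF cc_cont] continuous_intros) auto
    show "continuous_on ?K y0"
      using init unfolding y0_def initial_relaxations_def by (intro continuous_on_Pair) auto
    fix t k and y z :: "(real^'x) \<times> (real^'x)"
    assume t: "t \<in> ?I" and k: "k \<in> ?K"
    obtain p w where pw: "k = (p, w)" "p \<in> Q" "w \<in> \<Theta>" using k by auto
    obtain y1 y2 z1 z2 where yz: "y = (y1, y2)" "z = (z1, z2)" by fastforce
    have d: "dist (t, p, w, y1, y2) (t, p, w, z1, z2) = norm (y - z)"
      by (simp add: yz dist_Pair_Pair dist_norm norm_Pair)
    have "norm (F (t, k, y) - F (t, k, z)) \<le>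
        dist (fcv (t, p, w, y1, y2)) (fcv (t, p, w, z1, z2)) +
        dist (fcc (t, p, w, y1, y2)) (fcc (t, p, w, z1, z2))"
      unfolding F_def pw yz by (simp add: dist_norm norm_Pair sqrt_sum_squares_le_sum)
    also have "\<dots> \<le> Lv * norm (y - z) + Lc * norm (y - z)"
      unfolding d[symmetric] using t pw
      by (intro add_mono lipschitz_onD[OF Lv] lipschitz_onD[OF Lc]) auto
    also have "\<dots> \<le> (Lv + Lc + 1) * norm (y - z)"
      by (simp add: algebra_simps)
    finally show "norm (F (t, k, y) - F (t, k, z)) \<le> (Lv + Lc + 1) * norm (y - z)" .
  qed (use K nonneg in auto)
  have x_int: "((\<lambda>s. f (s, fst k, snd k, ?x s k)) has_integral (?x t k - x0 k)) {t0..t}"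
    if "k \<in> ?K" "t \<in> ?I" for k t
    using solves_ivp_has_integral[OF x_sol[of "fst k" "snd k"] that(2)] that(1) by (auto simp: split_beta)
  \<comment> \<open>Continuity is part of the invariant because \<open>dyn\<close> can only be
    applied to continuous functions; the relaxation property is demanded at every time because a
    step integrates over all earlier times.\<close>
  define Inv where "Inv = (\<lambda>\<Phi>. continuous_on D \<Phi> \<and> (\<forall>t\<in>?I.
    vec_convex_relaxation_on ?K (?x t) (\<lambda>k. fst (\<Phi> (t, k))) \<and>
    vec_concave_relaxation_on ?K (?x t) (\<lambda>k. snd (\<Phi> (t, k)))))"
  have step: "Inv (T \<Phi>)" if \<Phi>: "Inv \<Phi>" for \<Phi>
    unfolding Inv_def
  proof (intro conjI ballI)
    have c\<Phi>: "continuous_on D \<Phi>" using \<Phi> by (simp add: Inv_def)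
    then show "continuous_on D (T \<Phi>)" by (rule continuous_on_picard)
    define h c c' where "h = (\<lambda>s k. f (s, fst k, snd k, ?x s k))"
      and "c = (\<lambda>s k. fcv (s, fst k, snd k, fst (\<Phi> (s, k)), snd (\<Phi> (s, k))))"
      and "c' = (\<lambda>s k. fcc (s, fst k, snd k, fst (\<Phi> (s, k)), snd (\<Phi> (s, k))))"
    note dynD = dyn[unfolded dynamics_relaxations_def split_beta, THEN conjunct2, THEN conjunct2,
        rule_format, OF continuous_on_fst[OF c\<Phi>] continuous_on_snd[OF c\<Phi>]]
    have rel: "vec_convex_relaxation_on ?K (h s) (c s) \<and> vec_concave_relaxation_on ?K (h s) (c' s)"
      if "s \<in> ?I" for s
      using dynD[OF that] that \<Phi> unfolding Inv_def h_def c_def c'_def split_beta by simp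
    fix t assume t: "t \<in> ?I"
    have T_eq: "T \<Phi> (t, k) = (x0cv k + integral {t0..t} (\<lambda>s. c s k), x0cc k + integral {t0..t} (\<lambda>s. c' s k))"
      and int: "(\<lambda>s. c s k) integrable_on {t0..t}" "(\<lambda>s. c' s k) integrable_on {t0..t}"
      if k: "k \<in> ?K" for k
    proof -
      have "continuous_on {t0..t} (\<lambda>s. F (s, k, \<Phi> (s, k)))"
        using continuous_on_section[OF c\<Phi> k] t k by (intro continuous_on_F_comp) auto
      moreover have "F (s, k, \<Phi> (s, k)) = (c s k, c' s k)" for s
        by (simp add: F_def c_def c'_def split_beta)
      ultimately have "continuous_on {t0..t} (\<lambda>s. (c s k, c' s k))"
        by simp
      then have i: "(\<lambda>s. (c s k, c' s k)) integrable_on {t0..t}"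
        by (rule integrable_continuous_real)
      show "(\<lambda>s. c s k) integrable_on {t0..t}" "(\<lambda>s. c' s k) integrable_on {t0..t}"
        using integrable_linear[OF i bounded_linear_fst] integrable_linear[OF i bounded_linear_snd]
        by (simp_all add: o_def)
      have "integral {t0..t} (\<lambda>s. (c s k, c' s k)) =
          (integral {t0..t} (\<lambda>s. c s k), integral {t0..t} (\<lambda>s. c' s k))"
        using integral_linear[OF i bounded_linear_fst] integral_linear[OF i bounded_linear_snd]
        by (simp add: o_def prod_eq_iff)
      then show "T \<Phi> (t, k) = (x0cv k + integral {t0..t} (\<lambda>s. c s k), x0cc k + integral {t0..t} (\<lambda>s. c' s k))"
        by (simp add: picard_def y0_def \<open>\<And>s. F (s, k, \<Phi> (s, k)) = (c s k, c' s k)\<close>)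
    qed
    \<comment> \<open>The exact right-hand side integrates back to the flow itself, so the relaxed
      function is the same before and after the step.\<close>
    have x_eq: "x0 k + integral {t0..t} (\<lambda>s. h s k) = ?x t k" "(\<lambda>s. h s k) integrable_on {t0..t}"
      if "k \<in> ?K" for k
      using x_int[OF that t] unfolding h_def by (auto simp: integral_unique)
    have sub: "s \<in> ?I" if "s \<in> {t0..t}" for s using that t by auto
    have "vec_convex_relaxation_on ?K (\<lambda>k. x0 k + integral {t0..t} (\<lambda>s. h s k))
        (\<lambda>k. x0cv k + integral {t0..t} (\<lambda>s. c s k))"
      using init rel sub unfolding initial_relaxations_def
      by (intro vec_convex_relaxation_on_add_integral x_eq int) auto
    then show "vec_convex_relaxation_on ?K (?x t) (\<lambda>k. fst (T \<Phi> (t, k)))"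
      by (rule vec_convex_relaxation_on_cong[THEN iffD1, rotated 2]) (simp_all only: x_eq T_eq fst_conv)
    have "vec_concave_relaxation_on ?K (\<lambda>k. x0 k + integral {t0..t} (\<lambda>s. h s k))
        (\<lambda>k. x0cc k + integral {t0..t} (\<lambda>s. c' s k))"
      using init rel sub unfolding initial_relaxations_def
      by (intro vec_concave_relaxation_on_add_integral x_eq int) auto
    then show "vec_concave_relaxation_on ?K (?x t) (\<lambda>k. snd (T \<Phi> (t, k)))"
      by (rule vec_concave_relaxation_on_cong[THEN iffD1, rotated 2]) (simp_all only: x_eq T_eq snd_conv)
  qed
  \<comment> \<open>Continuity of the flow in all arguments is used here: it gives one bound
    \<open>B\<close> for all times and parameters, from which the constant starting pair is
    built.\<close>
  have "compact ((\<lambda>(t, p, w). x t p w) ` D)"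
    using x_cont K(1) by (intro compact_continuous_image compact_Times[OF compact_Icc])
  then obtain B where B: "\<And>t k. t \<in> ?I \<Longrightarrow> k \<in> ?K \<Longrightarrow> norm (?x t k) \<le> B"
    by (force dest!: compact_imp_bounded simp: bounded_iff)
  define \<Phi>0 :: "real \<times> (real^'p) \<times> (real^'w) \<Rightarrow> (real^'x) \<times> (real^'x)"
    where "\<Phi>0 = (\<lambda>_. (vec (- B), vec B))"
  have "Inv \<Phi>0"
    unfolding Inv_def \<Phi>0_def using B K(2) by (auto intro!: vec_relaxation_on_const)
  then have Inv: "Inv ((T ^^ n) \<Phi>0)" for n
    by (induction n) (auto intro: step)
  have c0: "continuous_on D \<Phi>0" by (simp add: \<Phi>0_def)
  obtain y where cy: "continuous_on D y"
    and lim: "\<And>z. z \<in> D \<Longrightarrow> (\<lambda>n. (T ^^ n) \<Phi>0 z) \<longlonglongrightarrow> y z"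
    and y: "\<And>k. k \<in> ?K \<Longrightarrow> unique_ivp_solution t0 tf (\<lambda>t y. F (t, k, y)) (y0 k) (\<lambda>t. y (t, k))"
    using picard_limit[OF le c0] by blast
  have tf: "tf \<in> ?I" using le by simp
  have cy_tf: "continuous_on ?K (\<lambda>k. y (tf, k))"
    using tf by (intro continuous_on_compose2[OF cy] continuous_intros) auto
  show ?thesis
  proof (rule that[of "\<lambda>t k. fst (y (t, k))" "\<lambda>t k. snd (y (t, k))"])
    show "continuous_on ?K (\<lambda>k. fst (y (tf, k)))" "continuous_on ?K (\<lambda>k. snd (y (tf, k)))"
      using cy_tf by (auto intro: continuous_on_fst continuous_on_snd)
    have iter: "vec_convex_relaxation_on ?K (?x tf) (\<lambda>k. fst ((T ^^ n) \<Phi>0 (tf, k)))"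
      "vec_concave_relaxation_on ?K (?x tf) (\<lambda>k. snd ((T ^^ n) \<Phi>0 (tf, k)))" for n
      using Inv[of n] tf unfolding Inv_def by blast+
    have lim_tf: "(\<lambda>n. (T ^^ n) \<Phi>0 (tf, k)) \<longlonglongrightarrow> y (tf, k)" if "k \<in> ?K" for k
      using lim[of "(tf, k)"] tf that by blast
    show "vec_convex_relaxation_on ?K (?x tf) (\<lambda>k. fst (y (tf, k)))"
      by (rule vec_convex_relaxation_on_LIMSEQ[OF iter(1) tendsto_fst[OF lim_tf]])
    show "vec_concave_relaxation_on ?K (?x tf) (\<lambda>k. snd (y (tf, k)))"
      by (rule vec_concave_relaxation_on_LIMSEQ[OF iter(2) tendsto_snd[OF lim_tf]])
    fix p w assume "p \<in> Q" "w \<in> \<Theta>"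
    then show "unique_relaxed_solution t0 tf fcv fcc x0cv x0cc p w
        (\<lambda>t. fst (y (t, (p, w)))) (\<lambda>t. snd (y (t, (p, w))))"
      using y[of "(p, w)"] by (simp only: unique_relaxed_solution_def F_def y0_def prod.case prod.collapse mem_Times_iff
          fst_conv snd_conv simp_thms)
  qed
qed

section \<open>Jensen's inequality and conditional expectation\<close>

text \<open>Jensen's inequality in several variables is this statement applied to the epigraph.\<close>

lemma (in prob_space) expectation_in_closed_convex:
  fixes X :: "'a \<Rightarrow> 'b::euclidean_space"
  assumes X: "integrable M X" and C: "closed C" "convex C" and AE: "AE s in M. X s \<in> C"
  shows "expectation X \<in> C"
proof (rule ccontr)
  assume "expectation X \<notin> C"
  then obtain a b where ab: "a \<bullet> expectation X < b" "\<And>y. y \<in> C \<Longrightarrow> a \<bullet> y > b"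
    using separating_hyperplane_closed_point[OF C(2,1)] by blast
  have "b = expectation (\<lambda>_. b)"
    by (simp add: prob_space)
  also have "\<dots> \<le> expectation (\<lambda>s. a \<bullet> X s)"
    using X AE ab(2) by (intro integral_mono_AE) (auto intro: less_imp_le)
  also have "\<dots> = a \<bullet> expectation X"
    using X by simp
  finally show False using ab(1) by simp
qed

text \<open>The pair (X, Y) lies almost everywhere in the epigraph of \<open>h\<close>, which is
  closed and convex, and so does its mean. The majorant \<open>Y\<close> stands in for the
  composition of \<open>h\<close> with \<open>X\<close>, since \<open>h\<close> is controlled on
  \<open>C\<close> only and measurability of the composition is not at hand.\<close>

lemma (in prob_space) jensen_closed_convex:
  fixes X :: "'a \<Rightarrow> 'b::euclidean_space"
  assumes X: "integrable M X" and Y: "integrable M Y"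
    and C: "closed C" and h: "convex_on C h" "continuous_on C h"
    and AE: "AE s in M. X s \<in> C \<and> h (X s) \<le> Y s"
  shows "expectation X \<in> C" "h (expectation X) \<le> expectation Y"
proof -
  have "closed {z \<in> C \<times> UNIV. h (fst z) \<le> snd z}"
    using C by (intro continuous_on_closed_Collect_le continuous_on_compose2[OF h(2)]
        continuous_intros closed_Times) auto
  also have "{z \<in> C \<times> UNIV. h (fst z) \<le> snd z} = epigraph C h"
    by (auto simp: epigraph_def)
  finally have cl: "closed (epigraph C h)" .
  have XY: "integrable M (\<lambda>s. (X s, Y s))"
    using Bochner_Integration.integrable_add[OF
        integrable_bounded_linear[OF bounded_linear_Pair[OF bounded_linear_ident bounded_linear_zero] X]
        integrable_bounded_linear[OF bounded_linear_Pair[OF bounded_linear_zero bounded_linear_ident] Y]]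
    by simp
  have "expectation (\<lambda>s. (X s, Y s)) \<in> epigraph C h"
    using AE h(1)
    by (intro expectation_in_closed_convex[OF XY cl]) (auto simp: convex_epigraph mem_epigraph)
  moreover have "expectation (\<lambda>s. (X s, Y s)) = (expectation X, expectation Y)"
    using integral_bounded_linear[OF bounded_linear_fst XY] integral_bounded_linear[OF bounded_linear_snd XY]
    by (simp add: prod_eq_iff)
  ultimately show "expectation X \<in> C" "h (expectation X) \<le> expectation Y"
    by (auto simp: mem_epigraph)
qed

section \<open>Conditioning on an event of positive probability\<close>

lemma (in prob_space) integral_uniform_measure:
  fixes Y :: "'a \<Rightarrow> real"
  assumes [measurable]: "A \<in> events" "Y \<in> borel_measurable M" and "prob A \<noteq> 0"
  shows "prob A * integral\<^sup>L (uniform_measure M A) Y = expectation (\<lambda>s. indicator A s * Y s)"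
proof -
  have "uniform_measure M A = density M (\<lambda>s. ennreal (indicator A s / prob A))"
    unfolding uniform_measure_def using assms(3)
    by (intro density_cong)
      (auto simp: emeasure_eq_measure divide_ennreal zero_less_measure_iff simp flip: ennreal_indicator)
  then have "integral\<^sup>L (uniform_measure M A) Y = expectation (\<lambda>s. indicator A s / prob A * Y s)"
    by (simp add: integral_density)
  also have "\<dots> = expectation (\<lambda>s. indicator A s * Y s / prob A)"
    by (intro Bochner_Integration.integral_cong) auto
  finally show ?thesis using assms(3) by simp
qed

text \<open>Jensen's inequality for the conditional measure, multiplied by the probability of the
  event so that the right-hand side is an integral over the original space and can be summed over
  cells. Compactness of \<open>C\<close> bounds both the random vector and \<open>h\<close> on the
  event, which gives integrability.\<close>

lemma (in prob_space) cond_expectation_in_jensen: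
  fixes W :: "'a \<Rightarrow> real^'w"
  assumes W[measurable]: "W \<in> borel_measurable M" and C: "compact C"
    and h: "convex_on C h" "continuous_on C h" and P: "prob_in M W C \<noteq> 0"
  shows "cond_expectation_in M W C \<in> C"
    and "prob_in M W C * h (cond_expectation_in M W C) \<le> expectation (\<lambda>s. indicator C (W s) * h (W s))"
proof -
  have [measurable]: "C \<in> sets borel"
    using C by (intro borel_closed compact_imp_closed)
  define A where "A = W -` C \<inter> space M"
  have A[measurable]: "A \<in> events" unfolding A_def by measurable
  have pA: "prob A \<noteq> 0" using P by (simp add: prob_in_def A_def)
  define Y where "Y = (\<lambda>s. indicator C (W s) * h (W s))"
  have "(\<lambda>w. indicator C w *\<^sub>R h w) \<in> borel_measurable borel"
    using h(2) by (intro borel_measurable_continuous_on_indicator) auto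
  from measurable_compose[OF W this] have Y[measurable]: "Y \<in> borel_measurable M"
    by (simp add: Y_def)
  interpret N: prob_space "uniform_measure M A"
    using pA by (intro prob_space_uniform_measure) (auto simp: emeasure_eq_measure)
  have ae: "AE s in uniform_measure M A. s \<in> A"
    by (intro AE_uniform_measureI) auto
  have "bounded C" "bounded (h ` C)"
    using C h(2) by (auto intro: compact_imp_bounded compact_continuous_image)
  then obtain B B' where B: "\<And>w. w \<in> C \<Longrightarrow> norm w \<le> B" "\<And>w. w \<in> C \<Longrightarrow> norm (h w) \<le> B'"
    by (force simp: bounded_iff)
  have X_int: "integrable (uniform_measure M A) W"
    using ae B(1) by (intro N.integrable_const_bound[where B = B]) (auto simp: A_def)
  have Y_int: "integrable (uniform_measure M A) Y"
  proof (rule N.integrable_const_bound[where B = B'])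
    show "AE s in uniform_measure M A. norm (Y s) \<le> B'"
      using ae by eventually_elim (use B(2) in \<open>auto simp: A_def Y_def\<close>)
  qed simp
  have rel: "AE s in uniform_measure M A. W s \<in> C \<and> h (W s) \<le> Y s"
    using ae by eventually_elim (auto simp: A_def Y_def)
  note jensen = N.jensen_closed_convex[OF X_int Y_int compact_imp_closed[OF C] h rel]
  have ce: "cond_expectation_in M W C = integral\<^sup>L (uniform_measure M A) W"
    by (simp add: cond_expectation_in_def A_def)
  show "cond_expectation_in M W C \<in> C"
    using jensen(1) by (simp add: ce)
  have "prob A * h (cond_expectation_in M W C) \<le> prob A * integral\<^sup>L (uniform_measure M A) Y"
    using jensen(2) by (intro mult_left_mono) (auto simp: ce)
  also have "\<dots> = expectation (\<lambda>s. indicator A s * Y s)"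
    by (rule integral_uniform_measure[OF A Y pA])
  also have "\<dots> = expectation Y"
    by (intro Bochner_Integration.integral_cong) (auto simp: A_def Y_def indicator_def)
  finally show "prob_in M W C * h (cond_expectation_in M W C) \<le>
      expectation (\<lambda>s. indicator C (W s) * h (W s))"
    by (simp add: prob_in_def A_def Y_def)
qed

text \<open>The passage from the sample space to Lebesgue measure is made for the Borel function
  \<open>H\<close> built from \<open>h\<close>, and \<open>G\<close> is compared only afterwards: of
  \<open>G\<close> it is merely known that its product with the density is Lebesgue integrable. On a
  cell of probability zero both the left-hand side and the expectation of \<open>H\<close> vanish,
  whatever \<open>m\<close> is.\<close>

lemma (in prob_space) cell_lower_bound:
  fixes W :: "'a \<Rightarrow> real^'w" and \<rho> :: "real^'w \<Rightarrow> real"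
  assumes W: "distributed M lborel W (\<lambda>w. ennreal (\<rho> w))" and \<rho>: "\<And>w. 0 \<le> \<rho> w"
    and C: "compact C" and h: "convex_on C h" "continuous_on C h"
    and m: "prob_in M W C \<noteq> 0 \<Longrightarrow> m = cond_expectation_in M W C"
    and le: "\<And>w. w \<in> C \<Longrightarrow> h w \<le> G w"
    and G: "set_integrable lebesgue C (\<lambda>w. G w * \<rho> w)"
  shows "prob_in M W C * h m \<le> (LINT w:C|lebesgue. G w * \<rho> w)"
proof -
  have Wm[measurable]: "W \<in> borel_measurable M"
    using distributed_measurable[OF W] by simp
  have [measurable]: "\<rho> \<in> borel_measurable borel"
    using distributed_real_measurable[OF _ W] \<rho> by simp
  have [measurable]: "C \<in> sets borel"
    using C by (intro borel_closed compact_imp_closed)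
  define H where "H = (\<lambda>w. indicator C w * h w)"
  have "(\<lambda>w. indicator C w *\<^sub>R h w) \<in> borel_measurable borel"
    using h(2) by (intro borel_measurable_continuous_on_indicator) auto
  then have H[measurable]: "H \<in> borel_measurable borel"
    by (simp add: H_def)
  have "bounded (h ` C)"
    using C h(2) by (auto intro: compact_imp_bounded compact_continuous_image)
  then obtain B where B: "\<And>w. w \<in> C \<Longrightarrow> norm (h w) \<le> B"
    by (force simp: bounded_iff)
  have "norm (H (W s)) \<le> max B 0" for s
    using B[of "W s"] by (auto simp: H_def indicator_def)
  then have H_int: "integrable M (\<lambda>s. H (W s))"
    by (intro integrable_const_bound[where B = "max B 0"]) auto
  have "prob_in M W C * h m \<le> expectation (\<lambda>s. H (W s))"
  proof (cases "prob_in M W C = 0")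
    case True
    have "{s \<in> space M. \<not> (W s \<notin> C)} = W -` C \<inter> space M" by auto
    with True have "AE s in M. W s \<notin> C"
      by (intro AE_I'[of "W -` C \<inter> space M"]) (auto simp: prob_in_def null_sets_def emeasure_eq_measure)
    then have "expectation (\<lambda>s. H (W s)) = 0"
      by (intro integral_eq_zero_AE) (auto simp: H_def)
    with True show ?thesis by simp
  next
    case False
    show ?thesis
      using cond_expectation_in_jensen(2)[OF Wm C h False] unfolding m[OF False] H_def .
  qed
  also have "\<dots> = (LINT w|lborel. \<rho> w * H w)"
    using W \<rho> by (intro distributed_integral[symmetric]) auto
  also have "\<dots> = (LINT w|lebesgue. \<rho> w * H w)"
    by (intro integral_completion[symmetric]) simp
  also have "\<dots> \<le> (LINT w:C|lebesgue. G w * \<rho> w)"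
    unfolding set_lebesgue_integral_def
  proof (rule integral_mono)
    have "integrable lborel (\<lambda>w. \<rho> w * H w)"
      using distributed_integrable[OF W, of H] H_int \<rho> by simp
    then show "integrable lebesgue (\<lambda>w. \<rho> w * H w)"
      by (simp add: integrable_completion)
    show "integrable lebesgue (\<lambda>w. indicator C w *\<^sub>R (G w * \<rho> w))"
      using G by (simp add: set_integrable_def)
    show "\<rho> w * H w \<le> indicator C w *\<^sub>R (G w * \<rho> w)" for w
      using le[of w] \<rho>[of w] by (auto simp: H_def indicator_def mult.commute[of "G w"] intro: mult_left_mono)
  qed
  finally show ?thesis .
qed

section \<open>Summation over the cells of an interval partition\<close>

lemma compact_intervals_imp:
  assumes "A \<in> compact_intervals S"
  shows "compact A" "convex A" "A \<subseteq> S"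
  using assms by (auto simp: compact_intervals_def interval_cbox)

text \<open>The overlap of two distinct cells is convex with empty interior, hence negligible. The
  argument covers degenerate cells as well.\<close>

lemma interval_partition_AE:
  assumes "interval_partition S n \<Omega>" "i \<in> {1..n}" "j \<in> {1..n}"
  shows "AE w in lebesgue. w \<in> \<Omega> i \<and> w \<in> \<Omega> j \<longrightarrow> i = j"
proof (cases "i = j")
  case False
  have "\<Omega> i \<in> compact_intervals S" "\<Omega> j \<in> compact_intervals S"
    and int: "interior (\<Omega> i) \<inter> interior (\<Omega> j) = {}"
    using assms False by (auto simp: interval_partition_def)
  then have "convex (\<Omega> i \<inter> \<Omega> j)"
    by (intro convex_Int compact_intervals_imp)
  then have "negligible (\<Omega> i \<inter> \<Omega> j)"
    using int by (simp add: negligible_convex_interior interior_Int)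
  then have "AE w in lebesgue. w \<notin> \<Omega> i \<inter> \<Omega> j"
    by (intro AE_not_in) (simp add: negligible_iff_null_sets)
  then show ?thesis by eventually_elim blast
qed simp

text \<open>Kept abstract in \<open>G\<close> and \<open>h\<close> so that it serves both bounds:
  with convex relaxations of the cost, and with negated concave relaxations of the negated
  cost.\<close>

lemma (in prob_space) partition_lower_bound:
  fixes W :: "'a \<Rightarrow> real^'w" and \<rho> :: "real^'w \<Rightarrow> real"
  assumes W: "distributed M lborel W (\<lambda>w. ennreal (\<rho> w))" and \<rho>: "\<And>w. 0 \<le> \<rho> w"
    and part: "interval_partition S n \<Omega>"
    and h: "\<And>i. i \<in> {1..n} \<Longrightarrow> convex_on (\<Omega> i) (h i)" "\<And>i. i \<in> {1..n} \<Longrightarrow> continuous_on (\<Omega> i) (h i)"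
    and m: "\<And>i. i \<in> {1..n} \<Longrightarrow> prob_in M W (\<Omega> i) \<noteq> 0 \<Longrightarrow> m i = cond_expectation_in M W (\<Omega> i)"
    and le: "\<And>i w. i \<in> {1..n} \<Longrightarrow> w \<in> \<Omega> i \<Longrightarrow> h i w \<le> G w"
    and G: "set_integrable lebesgue S (\<lambda>w. G w * \<rho> w)"
  shows "(\<Sum>i=1..n. prob_in M W (\<Omega> i) * h i (m i)) \<le> (LINT w:S|lebesgue. G w * \<rho> w)"
proof -
  have \<Omega>: "compact (\<Omega> i)" "\<Omega> i \<subseteq> S" if "i \<in> {1..n}" for i
    using part that compact_intervals_imp[of "\<Omega> i" S] by (auto simp: interval_partition_def)
  have sets: "\<Omega> i \<in> sets lebesgue" if "i \<in> {1..n}" for i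
    using \<Omega>(1)[OF that] by (auto dest!: compact_imp_closed)
  have Gi: "set_integrable lebesgue (\<Omega> i) (\<lambda>w. G w * \<rho> w)" if "i \<in> {1..n}" for i
    using set_integrable_subset[OF G sets[OF that] \<Omega>(2)[OF that]] .
  have "(\<Sum>i=1..n. prob_in M W (\<Omega> i) * h i (m i)) \<le> (\<Sum>i=1..n. LINT w:\<Omega> i|lebesgue. G w * \<rho> w)"
    using cell_lower_bound[OF W \<rho> \<Omega>(1) h m le Gi] by (intro sum_mono) blast
  also have "\<dots> = (LINT w:(\<Union>i\<in>{1..n}. \<Omega> i)|lebesgue. G w * \<rho> w)"
    using interval_partition_AE[OF part] sets Gi
    by (intro set_integral_finite_UN_AE[symmetric]) auto
  also have "(\<Union>i\<in>{1..n}. \<Omega> i) = S"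
    using part by (simp add: interval_partition_def)
  finally show ?thesis .
qed

section \<open>Relaxed costs\<close>

text \<open>Sections at a fixed random parameter make the relaxed problem convex in the decision;
  sections at a fixed decision are what Jensen's inequality is applied to.\<close>

lemma convex_on_sections:
  assumes "convex_on (A \<times> B) h"
  shows "convex A \<Longrightarrow> b \<in> B \<Longrightarrow> convex_on A (\<lambda>a. h (a, b))"
    and "convex B \<Longrightarrow> a \<in> A \<Longrightarrow> convex_on B (\<lambda>b. h (a, b))"
proof -
  show "convex_on A (\<lambda>a. h (a, b))" if "convex A" "b \<in> B"
  proof (rule convex_onI[OF _ that(1)])
    fix t :: real and x y assume "0 < t" "t < 1" "x \<in> A" "y \<in> A"
    then show "h ((1 - t) *\<^sub>R x + t *\<^sub>R y, b) \<le> (1 - t) * h (x, b) + t * h (y, b)"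
      using convex_onD[OF assms, of t "(x, b)" "(y, b)"] that(2)
      by (simp flip: scaleR_left_distrib)
  qed
  show "convex_on B (\<lambda>b. h (a, b))" if "convex B" "a \<in> A"
  proof (rule convex_onI[OF _ that(1)])
    fix t :: real and x y assume "0 < t" "t < 1" "x \<in> B" "y \<in> B"
    then show "h (a, (1 - t) *\<^sub>R x + t *\<^sub>R y) \<le> (1 - t) * h (a, x) + t * h (a, y)"
      using convex_onD[OF assms, of t "(a, x)" "(a, y)"] that(2)
      by (simp flip: scaleR_left_distrib)
  qed
qed

lemma convex_on_weighted_sum:
  assumes "finite I" "convex S" "\<And>i. i \<in> I \<Longrightarrow> 0 \<le> c i" "\<And>i. i \<in> I \<Longrightarrow> convex_on S (h i)"
  shows "convex_on S (\<lambda>s. \<Sum>i\<in>I. c i * h i s)"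
  using assms(1,3,4)
  by (induction I rule: finite_induct)
    (auto simp: convex_on_const assms(2) intro!: convex_on_add convex_on_cmul)

text \<open>Continuity of the composed costs is recorded beside convexity because a convex function
  on a compact cell may jump at its boundary, while the Jensen step relies on a closed epigraph. The
  existential form allows a choice of trajectories cell by cell.\<close>

lemma relaxed_costs:
  fixes x :: "real \<Rightarrow> real^'p \<Rightarrow> real^'w \<Rightarrow> real^'x"
  assumes "t0 \<le> tf" "compact Q" "convex Q" "compact \<Theta>" "convex \<Theta>"
    and "initial_relaxations x0 Q \<Theta> x0cv x0cc" "dynamics_relaxations t0 tf f x Q \<Theta> fcv fcc"
    and cost: "cost_relaxations tf g x Q \<Theta> gcv gcc"
    and "continuous_on ({t0..tf} \<times> (Q \<times> \<Theta>)) (\<lambda>(t, p, w). x t p w)"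
    and "\<And>p w. p \<in> Q \<Longrightarrow> w \<in> \<Theta> \<Longrightarrow>
      solves_ivp t0 tf (\<lambda>t y. f (t, p, w, y)) (x0 (p, w)) (\<lambda>t. x t p w)"
  shows "\<exists>(xcv :: real \<Rightarrow> (real^'p) \<times> (real^'w) \<Rightarrow> real^'x) xcc.
    (\<forall>p\<in>Q. \<forall>w\<in>\<Theta>. unique_relaxed_solution t0 tf fcv fcc x0cv x0cc p w
      (\<lambda>t. xcv t (p, w)) (\<lambda>t. xcc t (p, w))) \<and>
    continuous_on (Q \<times> \<Theta>) (\<lambda>(p, w). gcv (p, w, xcv tf (p, w), xcc tf (p, w))) \<and>
    continuous_on (Q \<times> \<Theta>) (\<lambda>(p, w). gcc (p, w, xcv tf (p, w), xcc tf (p, w))) \<and>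
    convex_relaxation_on (Q \<times> \<Theta>) (\<lambda>(p, w). g (p, w, x tf p w))
      (\<lambda>(p, w). gcv (p, w, xcv tf (p, w), xcc tf (p, w))) \<and>
    concave_relaxation_on (Q \<times> \<Theta>) (\<lambda>(p, w). g (p, w, x tf p w))
      (\<lambda>(p, w). gcc (p, w, xcv tf (p, w), xcc tf (p, w)))"
proof -
  obtain xcv xcc :: "real \<Rightarrow> (real^'p) \<times> (real^'w) \<Rightarrow> real^'x"
    where sol: "\<And>p w. p \<in> Q \<Longrightarrow> w \<in> \<Theta> \<Longrightarrow> unique_relaxed_solution t0 tf fcv fcc x0cv x0cc p w
        (\<lambda>t. xcv t (p, w)) (\<lambda>t. xcc t (p, w))"
    and cont: "continuous_on (Q \<times> \<Theta>) (xcv tf)" "continuous_on (Q \<times> \<Theta>) (xcc tf)"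
    and rel: "vec_convex_relaxation_on (Q \<times> \<Theta>) (\<lambda>(p, w). x tf p w) (xcv tf)"
      "vec_concave_relaxation_on (Q \<times> \<Theta>) (\<lambda>(p, w). x tf p w) (xcc tf)"
    using relaxed_solutions[OF assms(1-7,9,10)] by metis
  obtain Lv Lc where L: "Lv-lipschitz_on (Q \<times> \<Theta> \<times> UNIV \<times> UNIV) gcv"
    "Lc-lipschitz_on (Q \<times> \<Theta> \<times> UNIV \<times> UNIV) gcc"
    using cost unfolding cost_relaxations_def by blast
  have "continuous_on (Q \<times> \<Theta>) (\<lambda>(p, w). G (p, w, xcv tf (p, w), xcc tf (p, w)))"
    if "continuous_on (Q \<times> \<Theta> \<times> UNIV \<times> UNIV) G" for G :: "_ \<Rightarrow> real"
    unfolding split_beta prod.collapse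
    by (intro continuous_on_compose2[OF that] continuous_intros cont) auto
  note this[OF lipschitz_on_continuous_on[OF L(1)]] this[OF lipschitz_on_continuous_on[OF L(2)]]
  moreover note cost[unfolded cost_relaxations_def, THEN conjunct2, THEN conjunct2, rule_format,
      OF cont rel]
  ultimately show ?thesis
    using sol by blast
qed

text \<open>Quantifying the relaxed trajectories existentially loses nothing:
  \<open>unique_relaxed_solution\<close> determines them on \<open>{t0..tf}\<close>, so every choice
  has the same values at \<open>tf\<close>.\<close>

theorem corollary9:
  fixes t0 tf :: real
    and Pbar :: "(real^'p) set" and \<Omega>bar :: "(real^'w) set"
    and M :: "'s measure" and W :: "'s \<Rightarrow> real^'w" and \<rho> :: "real^'w \<Rightarrow> real"
    and x0 :: "(real^'p) \<times> (real^'w) \<Rightarrow> real^'x"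
    and f :: "real \<times> (real^'p) \<times> (real^'w) \<times> (real^'x) \<Rightarrow> real^'x"
    and x :: "real \<Rightarrow> real^'p \<Rightarrow> real^'w \<Rightarrow> real^'x"
    and g :: "(real^'p) \<times> (real^'w) \<times> (real^'x) \<Rightarrow> real"
    and x0cv x0cc :: "(real^'p) set \<Rightarrow> (real^'w) set \<Rightarrow> (real^'p) \<times> (real^'w) \<Rightarrow> real^'x"
    and fcv fcc :: "(real^'p) set \<Rightarrow> (real^'w) set \<Rightarrow>
      real \<times> (real^'p) \<times> (real^'w) \<times> (real^'x) \<times> (real^'x) \<Rightarrow> real^'x"
    and gcv gcc :: "(real^'p) set \<Rightarrow> (real^'w) set \<Rightarrow>
      (real^'p) \<times> (real^'w) \<times> (real^'x) \<times> (real^'x) \<Rightarrow> real"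
    and n :: nat and \<Omega> :: "nat \<Rightarrow> (real^'w) set" and \<omega> :: "nat \<Rightarrow> real^'w"
    and P :: "(real^'p) set"
  assumes time: "t0 \<le> tf"
    and Pbar: "Pbar \<in> compact_intervals UNIV"
    and \<Omega>bar: "\<Omega>bar \<in> compact_intervals UNIV"
    and M: "prob_space M"
    and W: "distributed M lborel W (\<lambda>w. ennreal (\<rho> w))"
    and \<rho>_nonneg: "\<And>w. 0 \<le> \<rho> w"
    and \<rho>_support: "\<And>w. w \<notin> \<Omega>bar \<Longrightarrow> \<rho> w = 0"
    and x0: "locally_lipschitz x0"
    and f: "locally_lipschitz f"
    and x: "\<And>p w. p \<in> Pbar \<Longrightarrow> w \<in> \<Omega>bar \<Longrightarrow>
      unique_ivp_solution t0 tf (\<lambda>t y. f (t, p, w, y)) (x0 (p, w)) (\<lambda>t. x t p w)"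
    and cost_exists: "\<And>p. p \<in> Pbar \<Longrightarrow>
      set_integrable lebesgue \<Omega>bar (\<lambda>w. g (p, w, x tf p w) * \<rho> w)"
    and x0_relax: "\<And>Q \<Theta>. Q \<in> compact_intervals Pbar \<Longrightarrow> \<Theta> \<in> compact_intervals \<Omega>bar \<Longrightarrow>
      initial_relaxations x0 Q \<Theta> (x0cv Q \<Theta>) (x0cc Q \<Theta>)"
    and f_relax: "\<And>Q \<Theta>. Q \<in> compact_intervals Pbar \<Longrightarrow> \<Theta> \<in> compact_intervals \<Omega>bar \<Longrightarrow>
      dynamics_relaxations t0 tf f x Q \<Theta> (fcv Q \<Theta>) (fcc Q \<Theta>)"
    and g_relax: "\<And>Q \<Theta>. Q \<in> compact_intervals Pbar \<Longrightarrow> \<Theta> \<in> compact_intervals \<Omega>bar \<Longrightarrow>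
      cost_relaxations tf g x Q \<Theta> (gcv Q \<Theta>) (gcc Q \<Theta>)"
    and partition: "interval_partition \<Omega>bar n \<Omega>"
    and \<omega>: "\<And>i. i \<in> {1..n} \<Longrightarrow> prob_in M W (\<Omega> i) \<noteq> 0 \<Longrightarrow>
      \<omega> i = cond_expectation_in M W (\<Omega> i)"
    and \<omega>_null: "\<And>i. i \<in> {1..n} \<Longrightarrow> prob_in M W (\<Omega> i) = 0 \<Longrightarrow> \<omega> i \<in> \<Omega> i"
    and P: "P \<in> compact_intervals Pbar"
  shows
    "(\<exists>xcv xcc :: nat \<Rightarrow> real \<Rightarrow> real^'p \<Rightarrow> real^'x.
        (\<forall>i\<in>{1..n}. \<forall>p\<in>P.
          unique_relaxed_solution t0 tf (fcv P (\<Omega> i)) (fcc P (\<Omega> i)) (x0cv P (\<Omega> i)) (x0cc P (\<Omega> i))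
            p (\<omega> i) (\<lambda>t. xcv i t p) (\<lambda>t. xcc i t p)) \<and>
        convex_on P (\<lambda>p. \<Sum>i=1..n. prob_in M W (\<Omega> i) *
          gcv P (\<Omega> i) (p, \<omega> i, xcv i tf p, xcc i tf p)) \<and>
        optimal_value P (\<lambda>p. \<Sum>i=1..n. prob_in M W (\<Omega> i) *
          gcv P (\<Omega> i) (p, \<omega> i, xcv i tf p, xcc i tf p))
        \<le> optimal_value P (expected_cost tf g x \<Omega>bar \<rho>)) \<and>
     (\<forall>p\<in>P. \<exists>xcv xcc :: nat \<Rightarrow> real \<Rightarrow> real^'x.
        (\<forall>i\<in>{1..n}.
          unique_relaxed_solution t0 tf (fcv {p..p} (\<Omega> i)) (fcc {p..p} (\<Omega> i))
            (x0cv {p..p} (\<Omega> i)) (x0cc {p..p} (\<Omega> i)) p (\<omega> i) (xcv i) (xcc i)) \<and>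
        optimal_value P (expected_cost tf g x \<Omega>bar \<rho>)
        \<le> ereal (\<Sum>i=1..n. prob_in M W (\<Omega> i) *
            gcc {p..p} (\<Omega> i) (p, \<omega> i, xcv i tf, xcc i tf)))"
proof -
  interpret prob_space M by (rule M)
  let ?pr = "\<lambda>i. prob_in M W (\<Omega> i)"
  note Pbar_props = compact_intervals_imp[OF Pbar] and \<Omega>bar_props = compact_intervals_imp[OF \<Omega>bar]
  note P_props = compact_intervals_imp[OF P]
  have W_meas: "W \<in> borel_measurable M"
    using distributed_measurable[OF W] by simp
  have cells: "\<Omega> i \<in> compact_intervals \<Omega>bar" if "i \<in> {1..n}" for i
    using partition that unfolding interval_partition_def by blast
  note cell_props = compact_intervals_imp[OF cells]
  have \<omega>_in: "\<omega> i \<in> \<Omega> i" if i: "i \<in> {1..n}" for i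
  proof (cases "?pr i = 0")
    case False
    \<comment> \<open>Membership of the mean in the cell is the first conclusion of the Jensen
      lemma; the zero function is a convenient convex integrand with which to invoke it.\<close>
    have "convex_on (\<Omega> i) (\<lambda>_. 0)" using cell_props(2)[OF i] by (simp add: convex_on_const)
    from cond_expectation_in_jensen(1)[OF W_meas cell_props(1)[OF i] this continuous_on_const False]
    show ?thesis using \<omega>[OF i False] by simp
  qed (rule \<omega>_null[OF i])
  \<comment> \<open>Derived once on the full parameter box and then restricted to every subbox on
    which relaxations are taken.\<close>
  have "continuous_on ({t0..tf} \<times> (Pbar \<times> \<Omega>bar)) (\<lambda>(t, k). case k of (p, w) \<Rightarrow> x t p w)"
  proof (rule unique_ivp_solution_continuous_on[where F = "\<lambda>(t, (p, w), y). f (t, p, w, y)" and ?y0.0 = x0])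
    show "compact (Pbar \<times> \<Omega>bar)"
      using Pbar_props(1) \<Omega>bar_props(1) by (rule compact_Times)
    show "continuous_on (Pbar \<times> \<Omega>bar) x0"
      by (rule locally_lipschitz_imp_continuous_on[OF x0])
    show "continuous_on ({t0..tf} \<times> (Pbar \<times> \<Omega>bar) \<times> UNIV) (\<lambda>(t, (p, w), y). f (t, p, w, y))"
      unfolding split_beta
      by (intro continuous_on_compose2[OF locally_lipschitz_imp_continuous_on[OF f, of UNIV]]
          continuous_intros) auto
    fix r :: real
    have "compact ({t0..tf} \<times> Pbar \<times> \<Omega>bar \<times> cball (0::real^'x) r)"
      using Pbar_props(1) \<Omega>bar_props(1) by (intro compact_Times compact_Icc compact_cball)
    then obtain L where L: "L-lipschitz_on ({t0..tf} \<times> Pbar \<times> \<Omega>bar \<times> cball 0 r) f"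
      by (rule locally_lipschitz_imp_lipschitz_on_compact[OF f])
    have "L-lipschitz_on (cball 0 r) (\<lambda>y. f (t, p, w, y))"
      if "t \<in> {t0..tf}" "p \<in> Pbar" "w \<in> \<Omega>bar" for t p w
    proof (rule lipschitz_onI)
      fix y z :: "real^'x" assume "y \<in> cball 0 r" "z \<in> cball 0 r"
      then show "dist (f (t, p, w, y)) (f (t, p, w, z)) \<le> L * dist y z"
        using lipschitz_onD[OF L, of "(t, p, w, y)" "(t, p, w, z)"] that by (simp add: dist_Pair_Pair)
    qed (rule lipschitz_on_nonneg[OF L])
    then show "\<exists>L. \<forall>t\<in>{t0..tf}. \<forall>k\<in>Pbar \<times> \<Omega>bar.
        L-lipschitz_on (cball 0 r) (\<lambda>y. (\<lambda>(t, (p, w), y). f (t, p, w, y)) (t, k, y))"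
      by (intro exI[of _ L]) auto
  qed (use time x in auto)
  then have x_cont: "continuous_on ({t0..tf} \<times> (Q \<times> \<Theta>)) (\<lambda>(t, p, w). x t p w)"
    if "Q \<subseteq> Pbar" "\<Theta> \<subseteq> \<Omega>bar" for Q \<Theta>
    by (rule continuous_on_subset) (use that in auto)
  have x_sol: "solves_ivp t0 tf (\<lambda>t y. f (t, p, w, y)) (x0 (p, w)) (\<lambda>t. x t p w)"
    if "p \<in> Pbar" "w \<in> \<Omega>bar" for p w
    using x[OF that] by (simp add: unique_ivp_solution_def)
  \<comment> \<open>Stated for an arbitrary decision box \<open>Q\<close>, since the lower bound
    takes \<open>P\<close> and the upper bound the one-point box \<open>{p..p}\<close>.\<close>
  have "\<exists>(xcv :: nat \<Rightarrow> real \<Rightarrow> (real^'p) \<times> (real^'w) \<Rightarrow> real^'x) xcc. \<forall>i\<in>{1..n}.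
    (\<forall>p\<in>Q. \<forall>w\<in>\<Omega> i. unique_relaxed_solution t0 tf (fcv Q (\<Omega> i)) (fcc Q (\<Omega> i))
      (x0cv Q (\<Omega> i)) (x0cc Q (\<Omega> i)) p w (\<lambda>t. xcv i t (p, w)) (\<lambda>t. xcc i t (p, w))) \<and>
    continuous_on (Q \<times> \<Omega> i) (\<lambda>(p, w). gcv Q (\<Omega> i) (p, w, xcv i tf (p, w), xcc i tf (p, w))) \<and>
    continuous_on (Q \<times> \<Omega> i) (\<lambda>(p, w). gcc Q (\<Omega> i) (p, w, xcv i tf (p, w), xcc i tf (p, w))) \<and>
    convex_relaxation_on (Q \<times> \<Omega> i) (\<lambda>(p, w). g (p, w, x tf p w))
      (\<lambda>(p, w). gcv Q (\<Omega> i) (p, w, xcv i tf (p, w), xcc i tf (p, w))) \<and>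
    concave_relaxation_on (Q \<times> \<Omega> i) (\<lambda>(p, w). g (p, w, x tf p w))
      (\<lambda>(p, w). gcc Q (\<Omega> i) (p, w, xcv i tf (p, w), xcc i tf (p, w)))"
    (is "\<exists>xcv xcc. \<forall>i\<in>{1..n}. ?R Q i (xcv i) (xcc i)")
    if Q: "Q \<in> compact_intervals Pbar" for Q
  proof -
    note Q_props = compact_intervals_imp[OF Q]
    have "\<forall>i\<in>{1..n}. \<exists>v c. ?R Q i v c"
    proof
      fix i assume i: "i \<in> {1..n}"
      show "\<exists>v c. ?R Q i v c"
        using Q_props(3) cell_props(3)[OF i]
        by (intro relaxed_costs[OF time Q_props(1,2) cell_props(1,2)[OF i] x0_relax[OF Q cells[OF i]]
              f_relax[OF Q cells[OF i]] g_relax[OF Q cells[OF i]] x_cont x_sol]) auto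
    qed
    from bchoice[OF this] obtain v where "\<forall>i\<in>{1..n}. \<exists>c. ?R Q i (v i) c" ..
    from bchoice[OF this] show ?thesis by blast
  qed
  note relaxations = this
  have section_cont: "continuous_on \<Theta> (\<lambda>w. H (p, w))"
    if "continuous_on (Q \<times> \<Theta>) H" "p \<in> Q" for Q \<Theta> p and H :: "(real^'p) \<times> (real^'w) \<Rightarrow> real"
    using that(2) by (intro continuous_on_compose2[OF that(1)] continuous_intros) auto
  show ?thesis
  proof (intro conjI ballI)
    obtain v c where R: "\<And>i. i \<in> {1..n} \<Longrightarrow> ?R P i (v i) (c i)"
      using relaxations[OF P] by blast
    define h where "h = (\<lambda>i (p, w). gcv P (\<Omega> i) (p, w, v i tf (p, w), c i tf (p, w)))"
    have h: "continuous_on (P \<times> \<Omega> i) (h i)" "convex_on (P \<times> \<Omega> i) (h i)"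
      "\<And>p w. p \<in> P \<Longrightarrow> w \<in> \<Omega> i \<Longrightarrow> h i (p, w) \<le> g (p, w, x tf p w)" if "i \<in> {1..n}" for i
      using R[OF that] by (auto simp: h_def convex_relaxation_on_def)
    let ?J = "\<lambda>p. \<Sum>i=1..n. ?pr i * gcv P (\<Omega> i) (p, \<omega> i, v i tf (p, \<omega> i), c i tf (p, \<omega> i))"
    have J: "?J = (\<lambda>p. \<Sum>i=1..n. ?pr i * h i (p, \<omega> i))"
      by (simp add: h_def)
    have sol: "\<forall>i\<in>{1..n}. \<forall>p\<in>P.
        unique_relaxed_solution t0 tf (fcv P (\<Omega> i)) (fcc P (\<Omega> i)) (x0cv P (\<Omega> i)) (x0cc P (\<Omega> i))
          p (\<omega> i) (\<lambda>t. v i t (p, \<omega> i)) (\<lambda>t. c i t (p, \<omega> i))"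
      using R \<omega>_in by blast
    have conv: "convex_on P ?J"
      unfolding J using P_props(2) h(2) \<omega>_in
      by (intro convex_on_weighted_sum convex_on_sections(1)) (auto simp: prob_in_def)
    have "?J p \<le> expected_cost tf g x \<Omega>bar \<rho> p" if p: "p \<in> P" for p
    proof -
      have "(\<Sum>i=1..n. ?pr i * h i (p, \<omega> i)) \<le> (LINT w:\<Omega>bar|lebesgue. g (p, w, x tf p w) * \<rho> w)"
      proof (rule partition_lower_bound[OF W \<rho>_nonneg partition])
        show "convex_on (\<Omega> i) (\<lambda>w. h i (p, w))" if "i \<in> {1..n}" for i
          using convex_on_sections(2)[OF h(2)[OF that] cell_props(2)[OF that] p] .
        show "continuous_on (\<Omega> i) (\<lambda>w. h i (p, w))" if "i \<in> {1..n}" for i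
          using section_cont[OF h(1)[OF that] p] .
        show "set_integrable lebesgue \<Omega>bar (\<lambda>w. g (p, w, x tf p w) * \<rho> w)"
          using p P_props(3) by (intro cost_exists) auto
      qed (use \<omega> h(3) p in auto)
      then show ?thesis by (simp add: h_def expected_cost_def)
    qed
    then have "optimal_value P ?J \<le> optimal_value P (expected_cost tf g x \<Omega>bar \<rho>)"
      unfolding optimal_value_def by (intro INF_mono) (auto intro: bexI)
    with sol conv show "\<exists>xcv xcc :: nat \<Rightarrow> real \<Rightarrow> real^'p \<Rightarrow> real^'x.
        (\<forall>i\<in>{1..n}. \<forall>p\<in>P.
          unique_relaxed_solution t0 tf (fcv P (\<Omega> i)) (fcc P (\<Omega> i)) (x0cv P (\<Omega> i)) (x0cc P (\<Omega> i))
            p (\<omega> i) (\<lambda>t. xcv i t p) (\<lambda>t. xcc i t p)) \<and>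
        convex_on P (\<lambda>p. \<Sum>i=1..n. ?pr i * gcv P (\<Omega> i) (p, \<omega> i, xcv i tf p, xcc i tf p)) \<and>
        optimal_value P (\<lambda>p. \<Sum>i=1..n. ?pr i * gcv P (\<Omega> i) (p, \<omega> i, xcv i tf p, xcc i tf p))
        \<le> optimal_value P (expected_cost tf g x \<Omega>bar \<rho>)"
      by (intro exI[of _ "\<lambda>i t p. v i t (p, \<omega> i)"] exI[of _ "\<lambda>i t p. c i t (p, \<omega> i)"] conjI)
  next
    fix p assume p: "p \<in> P"
    \<comment> \<open>An upper bound only has to control the expected cost at one decision, so the
      decision box shrinks to that point.\<close>
    have Q: "{p..p} \<in> compact_intervals Pbar"
      unfolding compact_intervals_def using p P_props(3) by (auto intro!: exI[of _ p])
    have pQ: "p \<in> {p..p}" by simp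
    obtain v c where R: "\<And>i. i \<in> {1..n} \<Longrightarrow> ?R {p..p} i (v i) (c i)"
      using relaxations[OF Q] by blast
    define h where "h = (\<lambda>i (q, w). gcc {p..p} (\<Omega> i) (q, w, v i tf (q, w), c i tf (q, w)))"
    have h: "continuous_on ({p..p} \<times> \<Omega> i) (h i)" "convex_on ({p..p} \<times> \<Omega> i) (\<lambda>z. - h i z)"
      "\<And>w. w \<in> \<Omega> i \<Longrightarrow> g (p, w, x tf p w) \<le> h i (p, w)" if "i \<in> {1..n}" for i
      using R[OF that] by (auto simp: h_def concave_relaxation_on_def concave_on_def)
    \<comment> \<open>A concave overestimator of the cost is, after negation, a convex
      underestimator of the negated cost; undoing the sign at the end reverses the
      inequality.\<close>
    have "(\<Sum>i=1..n. ?pr i * - h i (p, \<omega> i)) \<le> (LINT w:\<Omega>bar|lebesgue. - g (p, w, x tf p w) * \<rho> w)"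
    proof (rule partition_lower_bound[OF W \<rho>_nonneg partition])
      show "convex_on (\<Omega> i) (\<lambda>w. - h i (p, w))" if "i \<in> {1..n}" for i
        using convex_on_sections(2)[OF h(2)[OF that] cell_props(2)[OF that] pQ] .
      show "continuous_on (\<Omega> i) (\<lambda>w. - h i (p, w))" if "i \<in> {1..n}" for i
        using continuous_on_minus[OF section_cont[OF h(1)[OF that] pQ]] .
      show "set_integrable lebesgue \<Omega>bar (\<lambda>w. - g (p, w, x tf p w) * \<rho> w)"
        using cost_exists[of p] p P_props(3) by (auto simp: set_integrable_def)
    qed (use \<omega> h(3) in auto)
    then have "expected_cost tf g x \<Omega>bar \<rho> p \<le> (\<Sum>i=1..n. ?pr i * h i (p, \<omega> i))"
      by (simp add: expected_cost_def set_lebesgue_integral_def sum_negf)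
    \<comment> \<open>The cost at any feasible point bounds the infimum from above.\<close>
    then have "optimal_value P (expected_cost tf g x \<Omega>bar \<rho>) \<le> ereal (\<Sum>i=1..n. ?pr i * h i (p, \<omega> i))"
      unfolding optimal_value_def by (intro INF_lower2[OF p]) simp
    moreover have "\<forall>i\<in>{1..n}. unique_relaxed_solution t0 tf (fcv {p..p} (\<Omega> i)) (fcc {p..p} (\<Omega> i))
        (x0cv {p..p} (\<Omega> i)) (x0cc {p..p} (\<Omega> i)) p (\<omega> i) (\<lambda>t. v i t (p, \<omega> i)) (\<lambda>t. c i t (p, \<omega> i))"
      using R \<omega>_in pQ by blast
    ultimately show "\<exists>xcv xcc :: nat \<Rightarrow> real \<Rightarrow> real^'x.
        (\<forall>i\<in>{1..n}.
          unique_relaxed_solution t0 tf (fcv {p..p} (\<Omega> i)) (fcc {p..p} (\<Omega> i))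
            (x0cv {p..p} (\<Omega> i)) (x0cc {p..p} (\<Omega> i)) p (\<omega> i) (xcv i) (xcc i)) \<and>
        optimal_value P (expected_cost tf g x \<Omega>bar \<rho>)
        \<le> ereal (\<Sum>i=1..n. ?pr i * gcc {p..p} (\<Omega> i) (p, \<omega> i, xcv i tf, xcc i tf))"
      unfolding h_def
      by (intro exI[of _ "\<lambda>i t. v i t (p, \<omega> i)"] exI[of _ "\<lambda>i t. c i t (p, \<omega> i)"] conjI) simp_all
  qed
qed

end
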